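(* Assume the four assumptions ($\mathbf g$-relevant Hessian boundedness, Lipschitz Hessian, Krylov subspace regularity I, Krylov subspace regularity II) stated in the context, let $f^\star=\min_{\mathbf x} f(\mathbf x)$, and let $$K=\frac{\left(f(\mathbf x_0)-f^\star\right)\varepsilon_g^{-3/2}}{\min\{c_1,c_2,c_3\}},$$ where $$c_0=\frac{2\sigma}{\theta L_g+\sqrt{\theta^2L_g^2+2\sigma^2L_H}},\quad c_1=\rho_S\,\sigma\left(\frac{3\sigma(1-2\rho_S)}{L_H}\right)^2,\quad c_2=\rho_S\,\sigma\,c_0^2,\quad c_3=\rho_N\,\omega^{3/2}\sqrt{\frac{6(1-\rho_N)}{L_H}}.$$ Then after at most $K$ iterations of the first-order Newton-MR method (Algorithm A in the context), the approximate first-order optimality condition $\|\nabla f(\mathbf x_k)\|\le\varepsilon_g$ is satisfied.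
   Context: Setting: $f:\mathbb R^d\to\mathbb R$ is twice continuously differentiable and attains its minimum; $\mathbf g(\mathbf x)=\nabla f(\mathbf x)$, $\mathbf H(\mathbf x)=\nabla^2 f(\mathbf x)$, $\mathbf g_k=\mathbf g(\mathbf x_k)$, $\mathbf H_k=\mathbf H(\mathbf x_k)$; $\|\cdot\|$ is the Euclidean/spectral norm. Exact arithmetic is assumed. MINRES. For a symmetric $\mathbf H$ and $\mathbf g\ne\mathbf 0$ let $\mathcal K_t(\mathbf H,\mathbf g)=\mathrm{Span}\{\mathbf g,\mathbf H\mathbf g,\dots,\mathbf H^{t-1}\mathbf g\}$; the grade $g$ of $\mathbf g$ with respect to $\mathbf H$ is the integer with $\dim\mathcal K_t=\min\{t,g\}$ for all $t\ge1$. The MINRES iterates are $\mathbf s_0=\mathbf 0$, $\mathbf s_t=\arg\min_{\mathbf s\in\mathcal K_t(\mathbf H,\mathbf g)}\|\mathbf H\mathbf s+\mathbf g\|^2$ (if the minimizer is not unique, which can only occur at $t=g$ with $\mathbf g\notin\mathrm{Range}(\mathbf H)$, then $\mathbf s_g=\mathbf s_{g-1}$), with residuals $\mathbf r_t=-\mathbf g-\mathbf H\mathbf s_t$. The NPC (nonpositive curvature) condition is detected at iteration $t$ if $\mathbf r_{t-1}\neq\mathbf 0$ and $\langle\mathbf r_{t-1},\mathbf H\mathbf r_{t-1}\rangle\le0$. The procedure MINRES$(\mathbf H,\mathbf g,\eta)$ does, for $t=1,2,\dots$: if the NPC condition is detected at iteration $t$, return $\mathbf d=\mathbf r_{t-1}$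 with flag `NPC'; otherwise, if $\|\mathbf H\mathbf r_{t-1}\|\le\eta\|\mathbf H\mathbf s_{t-1}\|$, return $\mathbf d=\mathbf s_{t-1}$ with flag `SOL'; otherwise continue. Algorithm A (first-order Newton-MR). Inputs: $\mathbf x_0\in\mathbb R^d$, $0<\varepsilon_g\le1$, $\theta>0$, line-search parameters $0<\rho_S<1/2$ and $0<\rho_N<1$. While $\|\mathbf g_k\|>\varepsilon_g$: call MINRES$(\mathbf H_k,\mathbf g_k,\theta\sqrt{\varepsilon_g})$ to get $\mathbf d_k$ and a flag. If the flag is `SOL', let $\alpha_k$ be the largest $0<\alpha\le1$ with $f(\mathbf x_k+\alpha\mathbf d_k)\le f(\mathbf x_k)+\rho_S\,\alpha\langle\mathbf g_k,\mathbf d_k\rangle$; if the flag is `NPC', let $\alpha_k$ be the largest $\alpha>0$ with $f(\mathbf x_k+\alpha\mathbf d_k)\le f(\mathbf x_k)+\rho_N\,\alpha\langle\mathbf g_k,\mathbf d_k\rangle$. Set $\mathbf x_{k+1}=\mathbf x_k+\alpha_k\mathbf d_k$, $k\leftarrow k+1$. Assumptions. (1) $\mathbf g$-relevant Hessian boundedness: an eigenvalue $\lambda$ of $\mathbf H$ is $\mathbf g$-relevant if $\mathbf g$ is not orthogonal to the eigenspace $\mathrm{Null}(\mathbf H-\lambda\mathbf I)$. Let $\mathbf U$ be a matrix whose columns form an orthonormal basis of eigenvectors for the sum of the eigenspaces of all nonzero $\mathbf g$-relevant eigenvalues. There is $0\le L_g<\infty$ with $\|\mathbf U^\top\mathbf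 H(\mathbf x)\mathbf U\|\le L_g$ for all $\mathbf x\in\mathbb R^d$. (2) Lipschitz Hessian: $\|\nabla^2f(\mathbf x)-\nabla^2f(\mathbf y)\|\le L_H\|\mathbf x-\mathbf y\|$ for all $\mathbf x,\mathbf y$, with $0<L_H<\infty$. (3) Krylov subspace regularity I: there is $\sigma>0$ such that for every $\mathbf x\in\mathbb R^d$ and every $t\le g$, if the NPC condition has not been detected at iterations $1,\dots,t$ of MINRES applied to $\mathbf H(\mathbf x),\mathbf g(\mathbf x)$, then $\mathbf T_t\succeq\sigma\mathbf I$, where $\mathbf T_t=\mathbf V_t^\top\mathbf H(\mathbf x)\mathbf V_t$ and $\mathbf V_t$ is the orthonormal Lanczos basis of $\mathcal K_t(\mathbf H(\mathbf x),\mathbf g(\mathbf x))$; equivalently $\langle\mathbf s,\mathbf H(\mathbf x)\mathbf s\rangle\ge\sigma\|\mathbf s\|^2$ for all $\mathbf s\in\mathcal K_t(\mathbf H(\mathbf x),\mathbf g(\mathbf x))$. (4) Krylov subspace regularity II: there is $\omega>0$ such that for every iterate $\mathbf x_k$ of the algorithm at which MINRES returns the flag `NPC', the returned residual $\mathbf d_k$ satisfies $\|\mathbf d_k\|\ge\omega\|\mathbf g_k\|$.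
   Formalization: The bound "at most K iterations" is read with K rounded up to the next integer ⌈K⌉, since for non-integer K (for example 0 < K < 1 with ‖∇f(x_0)‖ > ε_g) the unrounded bound can fail. *)

theory Defs
  imports "HOL-Analysis.Analysis"
begin

text \<open>Matrices with a variable number \<open>m\<close> of columns in \<open>\<real>\<^sup>n\<close> are represented by column
  families \<open>v :: nat \<Rightarrow> real ^ 'n\<close>, of which only the indices \<open>i < m\<close> are used; square matrices
  of size \<open>m\<close> are functions on \<open>{..<m} \<times> {..<m}\<close>.\<close>

definition orthonormal_cols :: "nat \<Rightarrow> (nat \<Rightarrow> real ^ 'n) \<Rightarrow> bool" where
  "orthonormal_cols m v \<longleftrightarrow> (\<forall>i<m. \<forall>j<m. v i \<bullet> v j = (if i = j then 1 else 0))"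

text \<open>The entries of \<open>V\<^sup>T H V\<close>.\<close>

definition compression :: "real ^ 'n ^ 'n \<Rightarrow> (nat \<Rightarrow> real ^ 'n) \<Rightarrow> nat \<Rightarrow> nat \<Rightarrow> real" where
  "compression H v i j = v i \<bullet> (H *v v j)"

text \<open>Taking the supremum over the unit ball (rather than the unit sphere) makes the norm of the
  \<open>0 \<times> 0\<close> matrix equal to 0.\<close>

definition spectral_norm :: "nat \<Rightarrow> (nat \<Rightarrow> nat \<Rightarrow> real) \<Rightarrow> real" where
  "spectral_norm m A =
     (SUP c \<in> {c. L2_set c {..<m} \<le> 1}. L2_set (\<lambda>i. \<Sum>j<m. A i j * c j) {..<m})"

definition succeq_scaled_id :: "nat \<Rightarrow> (nat \<Rightarrow> nat \<Rightarrow> real) \<Rightarrow> real \<Rightarrow> bool" where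
  "succeq_scaled_id m A \<sigma> \<longleftrightarrow>
     (\<forall>c. (\<Sum>i<m. \<Sum>j<m. c i * A i j * c j) \<ge> \<sigma> * (\<Sum>i<m. (c i)\<^sup>2))"


definition eigenspace :: "real ^ 'n ^ 'n \<Rightarrow> real \<Rightarrow> (real ^ 'n) set" where
  "eigenspace H \<mu> = {v. H *v v = \<mu> *\<^sub>R v}"

definition relevant_eigenvalue :: "real ^ 'n ^ 'n \<Rightarrow> real ^ 'n \<Rightarrow> real \<Rightarrow> bool" where
  "relevant_eigenvalue H g \<mu> \<longleftrightarrow>
     eigenspace H \<mu> \<noteq> {0} \<and> \<not> (\<forall>v \<in> eigenspace H \<mu>. orthogonal g v)"

definition relevant_eigenbasis ::
    "real ^ 'n ^ 'n \<Rightarrow> real ^ 'n \<Rightarrow> nat \<Rightarrow> (nat \<Rightarrow> real ^ 'n) \<Rightarrow> bool" where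
  "relevant_eigenbasis H g m u \<longleftrightarrow>
     orthonormal_cols m u \<and>
     (\<forall>i<m. \<exists>\<mu>. \<mu> \<noteq> 0 \<and> relevant_eigenvalue H g \<mu> \<and> u i \<in> eigenspace H \<mu>) \<and>
     span (u ` {..<m}) = span (\<Union>\<mu> \<in> {\<mu>. \<mu> \<noteq> 0 \<and> relevant_eigenvalue H g \<mu>}. eigenspace H \<mu>)"


definition krylov :: "real ^ 'n ^ 'n \<Rightarrow> real ^ 'n \<Rightarrow> nat \<Rightarrow> (real ^ 'n) set" where
  "krylov H g t = span ((\<lambda>i. ((*v) H ^^ i) g) ` {..<t})"

definition grade :: "real ^ 'n ^ 'n \<Rightarrow> real ^ 'n \<Rightarrow> nat" where
  "grade H g = (THE m. \<forall>t\<ge>1. dim (krylov H g t) = min t m)"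

text \<open>Orthonormality together with the nested spans determines the Lanczos vectors up to sign.\<close>

definition lanczos_basis ::
    "real ^ 'n ^ 'n \<Rightarrow> real ^ 'n \<Rightarrow> nat \<Rightarrow> (nat \<Rightarrow> real ^ 'n) \<Rightarrow> bool" where
  "lanczos_basis H g t v \<longleftrightarrow>
     orthonormal_cols t v \<and> (\<forall>j\<le>t. span (v ` {..<j}) = krylov H g j)"


definition minres_minimizer ::
    "real ^ 'n ^ 'n \<Rightarrow> real ^ 'n \<Rightarrow> nat \<Rightarrow> real ^ 'n \<Rightarrow> bool" where
  "minres_minimizer H g t s \<longleftrightarrow>
     is_arg_min (\<lambda>s. (norm (H *v s + g))\<^sup>2) (\<lambda>s. s \<in> krylov H g t) s"

text \<open>For symmetric \<open>H\<close> and \<open>t \<le> grade H g\<close>, uniqueness can only fail at \<open>t = grade H g\<close>, so the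
  second branch is the convention that the last iterate then repeats the previous one.\<close>

primrec minres_s :: "real ^ 'n ^ 'n \<Rightarrow> real ^ 'n \<Rightarrow> nat \<Rightarrow> real ^ 'n" where
  "minres_s H g 0 = 0"
| "minres_s H g (Suc t) =
     (if \<exists>!s. minres_minimizer H g (Suc t) s
      then THE s. minres_minimizer H g (Suc t) s
      else minres_s H g t)"

definition minres_r :: "real ^ 'n ^ 'n \<Rightarrow> real ^ 'n \<Rightarrow> nat \<Rightarrow> real ^ 'n" where
  "minres_r H g t = - g - H *v minres_s H g t"

definition npc_detected :: "real ^ 'n ^ 'n \<Rightarrow> real ^ 'n \<Rightarrow> nat \<Rightarrow> bool" where
  "npc_detected H g t \<longleftrightarrow>
     t \<ge> 1 \<and> minres_r H g (t - 1) \<noteq> 0 \<and>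
     minres_r H g (t - 1) \<bullet> (H *v minres_r H g (t - 1)) \<le> 0"

definition sol_detected :: "real ^ 'n ^ 'n \<Rightarrow> real ^ 'n \<Rightarrow> real \<Rightarrow> nat \<Rightarrow> bool" where
  "sol_detected H g \<eta> t \<longleftrightarrow>
     t \<ge> 1 \<and> norm (H *v minres_r H g (t - 1)) \<le> \<eta> * norm (H *v minres_s H g (t - 1))"

datatype minres_flag = SOL | NPC

definition minres ::
    "real ^ 'n ^ 'n \<Rightarrow> real ^ 'n \<Rightarrow> real \<Rightarrow> (real ^ 'n) \<times> minres_flag" where
  "minres H g \<eta> =
     (let t = (LEAST t. npc_detected H g t \<or> sol_detected H g \<eta> t)
      in if npc_detected H g t then (minres_r H g (t - 1), NPC)
         else (minres_s H g (t - 1), SOL))"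


definition step_size ::
    "(real ^ 'n \<Rightarrow> real) \<Rightarrow> (real ^ 'n \<Rightarrow> real ^ 'n) \<Rightarrow> real \<Rightarrow> real \<Rightarrow>
     real ^ 'n \<Rightarrow> real ^ 'n \<Rightarrow> minres_flag \<Rightarrow> real" where
  "step_size f g \<rho>\<^sub>S \<rho>\<^sub>N x d flag =
     (case flag of
        SOL \<Rightarrow> (GREATEST \<alpha>. 0 < \<alpha> \<and> \<alpha> \<le> 1 \<and> f (x + \<alpha> *\<^sub>R d) \<le> f x + \<rho>\<^sub>S * \<alpha> * (g x \<bullet> d))
      | NPC \<Rightarrow> (GREATEST \<alpha>. 0 < \<alpha> \<and> f (x + \<alpha> *\<^sub>R d) \<le> f x + \<rho>\<^sub>N * \<alpha> * (g x \<bullet> d)))"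

text \<open>Iterates of first-order Newton-MR for objective \<open>f\<close> with gradient \<open>g\<close> and Hessian \<open>H\<close>; once
  the loop condition \<open>norm (g x) > \<epsilon>\<close> fails, the sequence is continued as a constant.\<close>

primrec newton_mr ::
    "(real ^ 'n \<Rightarrow> real) \<Rightarrow> (real ^ 'n \<Rightarrow> real ^ 'n) \<Rightarrow> (real ^ 'n \<Rightarrow> real ^ 'n ^ 'n) \<Rightarrow>
     real \<Rightarrow> real \<Rightarrow> real \<Rightarrow> real \<Rightarrow> real ^ 'n \<Rightarrow> nat \<Rightarrow> real ^ 'n" where
  "newton_mr f g H \<epsilon> \<theta> \<rho>\<^sub>S \<rho>\<^sub>N x\<^sub>0 0 = x\<^sub>0"
| "newton_mr f g H \<epsilon> \<theta> \<rho>\<^sub>S \<rho>\<^sub>N x\<^sub>0 (Suc k) =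
     (let x = newton_mr f g H \<epsilon> \<theta> \<rho>\<^sub>S \<rho>\<^sub>N x\<^sub>0 k
      in if norm (g x) > \<epsilon>
         then (let (d, flag) = minres (H x) (g x) (\<theta> * sqrt \<epsilon>)
               in x + step_size f g \<rho>\<^sub>S \<rho>\<^sub>N x d flag *\<^sub>R d)
         else x)"

end

theory Submission imports Defs begin

text \<open>
  Each iteration whose start and end point both have gradient norm above \<open>\<epsilon>\<^sub>g\<close> decreases \<open>f\<close> by at
  least \<open>\<delta> = min {c\<^sub>1, c\<^sub>2, c\<^sub>3} \<epsilon>\<^sub>g\<^bsup>3/2\<^esup>\<close>: the decrease is at least \<open>c\<^sub>1\<close>, \<open>c\<^sub>2 \<epsilon>\<^sub>g\<close> or
  \<open>c\<^sub>3 \<epsilon>\<^sub>g\<^bsup>3/2\<^esup>\<close>, depending on the step, and \<open>\<epsilon>\<^sub>g \<le> 1\<close>. Since \<open>K \<delta> = f x\<^sub>0 - f_star\<close>, if none of the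
  iterates up to \<open>\<lceil>K\<rceil>\<close> satisfied the optimality condition, the last of them would be a minimizer,
  where the gradient is zero.

  MINRES. While the residuals \<open>r\<^sub>i\<close> have positive curvature, they are pairwise \<open>H\<close>-orthogonal, so
  they form a basis of the Krylov subspace and the iterate \<open>s\<^sub>t\<close> is the unique minimizer
  (\<open>minres_optimal\<close>). Orthogonality of \<open>r\<^sub>t\<close> to \<open>H\<close> times the Krylov subspace gives
  \<open>r\<^sub>t \<bullet> r\<^sub>i = (norm r\<^sub>t)\<^sup>2\<close> for \<open>i \<le> t\<close>. In particular \<open>g \<bullet> r\<^sub>t = - (norm r\<^sub>t)\<^sup>2\<close>, and \<open>s\<^sub>t\<close> is a
  nonnegative combination of earlier residuals, so \<open>r\<^sub>t \<bullet> s\<^sub>t \<ge> 0\<close>, which says that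
  \<open>g \<bullet> s\<^sub>t \<le> - s\<^sub>t \<bullet> H s\<^sub>t\<close>. So both kinds of returned direction are descent directions
  (\<open>npc_direction\<close>, \<open>sol_direction\<close>).

  Decrease. The cubic Taylor bound of \<open>f\<close> gives a lower bound on the accepted step size. For a
  direction \<open>d\<close> of nonpositive curvature the decrease is of order \<open>(norm d)\<^bsup>3/2\<^esup>\<close>, and \<open>norm d\<close> is at
  least \<open>\<omega> \<epsilon>\<^sub>g\<close>; this is the constant \<open>c\<^sub>3\<close>. For an approximate solution \<open>d\<close>, a step size below 1
  means that \<open>d\<close> is long and yields \<open>c\<^sub>1\<close>. With step size 1, the gradient at the new point is at most the
  residual plus \<open>L\<^sub>H (norm d)\<^sup>2 / 2\<close>, and the residual is at most
  \<open>\<theta> sqrt \<epsilon>\<^sub>g L\<^sub>g norm d / \<sigma>\<close> by the stopping test and \<open>norm (H d) \<le> L\<^sub>g norm d\<close>. As the new gradient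
  exceeds \<open>\<epsilon>\<^sub>g\<close>, \<open>norm d\<close> exceeds the root \<open>c\<^sub>0 sqrt \<epsilon>\<^sub>g\<close> of a quadratic
  (\<open>full_step_length\<close>), which yields \<open>c\<^sub>2\<close>.

  The bound \<open>norm (H d) \<le> L\<^sub>g norm d\<close> for \<open>d\<close> in a Krylov subspace holds because \<open>g\<close> is the sum of
  a vector in the relevant eigenspaces and a vector in the kernel of \<open>H\<close>
  (\<open>hessian_bounded_on_krylov\<close>).
\<close>

section \<open>Taylor bounds and symmetry of the Hessian\<close>

locale lipschitz_hessian =
  fixes f :: "real ^ 'n \<Rightarrow> real"
    and g :: "real ^ 'n \<Rightarrow> real ^ 'n"
    and H :: "real ^ 'n \<Rightarrow> real ^ 'n ^ 'n"
    and L :: real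
  assumes gradient: "GDERIV f y :> g y"
    and hessian: "(g has_derivative (\<lambda>h. H y *v h)) (at y)"
    and lipschitz: "onorm ((*v) (H y - H z)) \<le> L * norm (y - z)"
begin

lemma hessian_apply_lipschitz:
  "norm (H y *v v - H z *v v) \<le> L * norm (y - z) * norm v"
proof -
  have "norm ((H y - H z) *v v) \<le> onorm ((*v) (H y - H z)) * norm v"
    by (rule onorm) (rule matrix_vector_mul_bounded_linear)
  also have "\<dots> \<le> L * norm (y - z) * norm v"
    by (intro mult_right_mono lipschitz) simp
  finally show ?thesis
    by (simp add: matrix_vector_mult_diff_rdistrib)
qed

lemma objective_derivative_along_line:
  "((\<lambda>t. f (a + t *\<^sub>R p)) has_real_derivative g (a + t *\<^sub>R p) \<bullet> p) (at t)"
proof -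
  have "((\<lambda>t. f (a + t *\<^sub>R p)) has_derivative (\<lambda>h. (h *\<^sub>R p) \<bullet> g (a + t *\<^sub>R p))) (at t)"
    by (rule has_derivative_compose[where f = "\<lambda>t. a + t *\<^sub>R p" and g = f])
      (auto intro!: derivative_eq_intros simp: gradient[unfolded gderiv_def])
  then show ?thesis
    by (simp add: has_field_derivative_def inner_commute mult_commute_abs)
qed

lemma gradient_derivative_along_line:
  "((\<lambda>t. g (a + t *\<^sub>R p) \<bullet> w) has_real_derivative (H (a + t *\<^sub>R p) *v p) \<bullet> w) (at t)"
proof -
  have "((\<lambda>t. g (a + t *\<^sub>R p)) has_derivative (\<lambda>h. H (a + t *\<^sub>R p) *v (h *\<^sub>R p))) (at t)"
    by (rule has_derivative_compose[where f = "\<lambda>t. a + t *\<^sub>R p" and g = g])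
      (auto intro!: derivative_eq_intros simp: hessian)
  then have "((\<lambda>t. g (a + t *\<^sub>R p) \<bullet> w) has_derivative
      (\<lambda>h. (H (a + t *\<^sub>R p) *v (h *\<^sub>R p)) \<bullet> w)) (at t)"
    by (rule has_derivative_inner_left)
  then show ?thesis
    by (simp add: has_field_derivative_def matrix_vector_mult_scaleR mult_commute_abs)
qed

text \<open>A scalar mean value argument suffices because the error vector \<open>w\<close> itself serves as the test
direction: a bound on \<open>w \<bullet> w\<close> by a multiple of \<open>norm w\<close> is a bound on \<open>norm w\<close>.\<close>

lemma gradient_taylor:
  "norm (g (a + p) - g a - H a *v p) \<le> L / 2 * (norm p)\<^sup>2"
proof -
  define w where "w = g (a + p) - g a - H a *v p"
  define b c where "b = (H a *v p) \<bullet> w" and "c = L * (norm p)\<^sup>2 * norm w"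
  define \<psi> where "\<psi> t = g (a + t *\<^sub>R p) \<bullet> w - t * b - t\<^sup>2 * (c / 2)" for t
  have "\<psi> 1 \<le> \<psi> 0"
  proof (rule DERIV_nonpos_imp_nonincreasing[of 0 1 \<psi>])
    fix t :: real assume t: "0 \<le> t" "t \<le> 1"
    have "(\<psi> has_real_derivative (H (a + t *\<^sub>R p) *v p) \<bullet> w - b - t * c) (at t)"
      unfolding \<psi>_def
      by (auto intro!: derivative_eq_intros gradient_derivative_along_line)
    moreover have "(H (a + t *\<^sub>R p) *v p - H a *v p) \<bullet> w \<le> t * c"
    proof -
      have "(H (a + t *\<^sub>R p) *v p - H a *v p) \<bullet> w
          \<le> norm (H (a + t *\<^sub>R p) *v p - H a *v p) * norm w"
        by (rule norm_cauchy_schwarz)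
      also have "\<dots> \<le> (L * norm (a + t *\<^sub>R p - a) * norm p) * norm w"
        by (intro mult_right_mono hessian_apply_lipschitz) simp
      finally show ?thesis
        using t by (simp add: c_def power2_eq_square mult_ac)
    qed
    ultimately show "\<exists>y. (\<psi> has_real_derivative y) (at t) \<and> y \<le> 0"
      by (intro exI conjI) (auto simp: inner_diff_left b_def)
  qed simp
  then have "w \<bullet> w \<le> L / 2 * (norm p)\<^sup>2 * norm w"
    by (simp add: \<psi>_def b_def c_def) (simp add: w_def inner_diff_left)
  then have "norm w * norm w \<le> (L / 2 * (norm p)\<^sup>2) * norm w"
    by (simp add: power2_norm_eq_inner[symmetric] power2_eq_square)
  moreover have "0 \<le> L / 2 * (norm p)\<^sup>2"
  proof -
    have "0 \<le> onorm ((*v) (H (a + p) - H a))"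
      by (rule onorm_pos_le) (rule matrix_vector_mul_bounded_linear)
    also have "\<dots> \<le> L * norm p" using lipschitz[of "a + p" a] by simp
    finally have "0 \<le> L * norm p * norm p" by simp
    then show ?thesis by (simp add: power2_eq_square mult_ac)
  qed
  ultimately have "norm w \<le> L / 2 * (norm p)\<^sup>2"
    by (cases "w = 0") auto
  then show ?thesis by (simp add: w_def)
qed

lemma objective_taylor:
  "f (a + p) \<le> f a + g a \<bullet> p + p \<bullet> (H a *v p) / 2 + L / 6 * norm p ^ 3"
proof -
  define b c e where "b = g a \<bullet> p" and "c = p \<bullet> (H a *v p)" and "e = L * norm p ^ 3"
  define \<phi> where "\<phi> t = f (a + t *\<^sub>R p) - t * b - t\<^sup>2 * (c / 2) - t ^ 3 * (e / 6)" for t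
  have "\<phi> 1 \<le> \<phi> 0"
  proof (rule DERIV_nonpos_imp_nonincreasing[of 0 1 \<phi>])
    fix t :: real assume t: "0 \<le> t" "t \<le> 1"
    have "(\<phi> has_real_derivative g (a + t *\<^sub>R p) \<bullet> p - b - t * c - t\<^sup>2 * (e / 2)) (at t)"
      unfolding \<phi>_def
      by (auto intro!: derivative_eq_intros objective_derivative_along_line)
    moreover have "(g (a + t *\<^sub>R p) - g a - H a *v (t *\<^sub>R p)) \<bullet> p \<le> t\<^sup>2 * (e / 2)"
    proof -
      have "(g (a + t *\<^sub>R p) - g a - H a *v (t *\<^sub>R p)) \<bullet> p
          \<le> norm (g (a + t *\<^sub>R p) - g a - H a *v (t *\<^sub>R p)) * norm p"
        by (rule norm_cauchy_schwarz)
      also have "\<dots> \<le> (L / 2 * (norm (t *\<^sub>R p))\<^sup>2) * norm p"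
        by (intro mult_right_mono gradient_taylor) simp
      finally show ?thesis
        by (simp add: e_def power_mult_distrib power3_eq_cube power2_eq_square mult_ac)
    qed
    ultimately show "\<exists>y. (\<phi> has_real_derivative y) (at t) \<and> y \<le> 0"
      by (intro exI conjI)
        (auto simp: b_def c_def inner_diff_left inner_diff_right inner_commute
          matrix_vector_mult_scaleR algebra_simps)
  qed simp
  then show ?thesis by (simp add: \<phi>_def b_def c_def e_def)
qed

text \<open>The second difference is an increment in the direction \<open>u\<close> of the increment in the direction \<open>v\<close>,
so the mean value theorem in each direction turns it into a value of the Hessian form at \<open>u\<close> and
\<open>v\<close>. It does not change when \<open>u\<close> and \<open>v\<close> are exchanged, and this is where the symmetry of the
Hessian comes from.\<close>

lemma second_difference_mean_value:
  assumes "0 < s"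
  shows "\<exists>\<xi> \<zeta>. 0 < \<xi> \<and> \<xi> < s \<and> 0 < \<zeta> \<and> \<zeta> < s \<and>
    f (a + s *\<^sub>R u + s *\<^sub>R v) - f (a + s *\<^sub>R u) - f (a + s *\<^sub>R v) + f a
      = s\<^sup>2 * ((H (a + \<xi> *\<^sub>R u + \<zeta> *\<^sub>R v) *v v) \<bullet> u)"
proof -
  define \<phi> where "\<phi> t = f ((a + s *\<^sub>R v) + t *\<^sub>R u) - f (a + t *\<^sub>R u)" for t
  have D: "(\<phi> has_real_derivative g ((a + s *\<^sub>R v) + t *\<^sub>R u) \<bullet> u - g (a + t *\<^sub>R u) \<bullet> u) (at t)" for t
    unfolding \<phi>_def by (intro DERIV_diff objective_derivative_along_line)
  obtain \<xi> where \<xi>: "0 < \<xi>" "\<xi> < s"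
    "\<phi> s - \<phi> 0 = (s - 0) * (g ((a + s *\<^sub>R v) + \<xi> *\<^sub>R u) \<bullet> u - g (a + \<xi> *\<^sub>R u) \<bullet> u)"
    using MVT2[OF assms D] by blast
  obtain \<zeta> where \<zeta>: "0 < \<zeta>" "\<zeta> < s"
    "g ((a + \<xi> *\<^sub>R u) + s *\<^sub>R v) \<bullet> u - g ((a + \<xi> *\<^sub>R u) + 0 *\<^sub>R v) \<bullet> u
      = (s - 0) * ((H ((a + \<xi> *\<^sub>R u) + \<zeta> *\<^sub>R v) *v v) \<bullet> u)"
    using MVT2[OF assms gradient_derivative_along_line[of "a + \<xi> *\<^sub>R u" v u]] by blast
  have "\<phi> s - \<phi> 0 = s * (s * ((H (a + \<xi> *\<^sub>R u + \<zeta> *\<^sub>R v) *v v) \<bullet> u))"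
    using \<xi>(3) \<zeta>(3) by (simp add: add_ac)
  then show ?thesis
    using \<xi>(1,2) \<zeta>(1,2)
    by (intro exI[of _ \<xi>] exI[of _ \<zeta>]) (simp add: \<phi>_def add_ac power2_eq_square)
qed

text \<open>Both orders of differentiation give the same second difference with step \<open>s\<close>. By the Lipschitz
condition, evaluating the Hessian at the intermediate points instead of at \<open>a\<close> costs \<open>O(s)\<close>, so the
two values of the Hessian form differ by at most \<open>C * s\<close> for every \<open>s > 0\<close>.\<close>

lemma hessian_symmetric:
  assumes "0 \<le> L"
  shows "transpose (H a) = H a"
proof -
  have "(H a *v v) \<bullet> u = (H a *v u) \<bullet> v" for u v
  proof -
    define C where "C = 2 * L * (norm u + norm v) * norm u * norm v"
    have close: "\<bar>(H (a + \<xi> *\<^sub>R u + \<zeta> *\<^sub>R v) *v p - H a *v p) \<bullet> q\<bar>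
        \<le> L * (s * (norm u + norm v)) * norm p * norm q"
      if "0 < \<xi>" "\<xi> < s" "0 < \<zeta>" "\<zeta> < s" for s \<xi> \<zeta> :: real and p q
    proof -
      have "norm (\<xi> *\<^sub>R u + \<zeta> *\<^sub>R v) \<le> \<xi> * norm u + \<zeta> * norm v"
        using that norm_triangle_ineq[of "\<xi> *\<^sub>R u" "\<zeta> *\<^sub>R v"] by simp
      also have "\<dots> \<le> s * norm u + s * norm v"
        using that by (intro add_mono mult_right_mono) auto
      finally have small: "norm (\<xi> *\<^sub>R u + \<zeta> *\<^sub>R v) \<le> s * (norm u + norm v)"
        by (simp add: algebra_simps)
      have "\<bar>(H (a + \<xi> *\<^sub>R u + \<zeta> *\<^sub>R v) *v p - H a *v p) \<bullet> q\<bar>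
          \<le> norm (H (a + \<xi> *\<^sub>R u + \<zeta> *\<^sub>R v) *v p - H a *v p) * norm q"
        by (rule Cauchy_Schwarz_ineq2)
      also have "\<dots> \<le> L * norm (a + \<xi> *\<^sub>R u + \<zeta> *\<^sub>R v - a) * norm p * norm q"
        by (intro mult_right_mono hessian_apply_lipschitz) simp
      also have "\<dots> \<le> L * (s * (norm u + norm v)) * norm p * norm q"
        using small assms by (intro mult_right_mono mult_left_mono) (auto simp: add.assoc)
      finally show ?thesis .
    qed
    have bound: "\<bar>(H a *v v) \<bullet> u - (H a *v u) \<bullet> v\<bar> \<le> C * s" if s: "0 < s" for s
    proof -
      obtain \<xi> \<zeta> where 1: "0 < \<xi>" "\<xi> < s" "0 < \<zeta>" "\<zeta> < s"
        "f (a + s *\<^sub>R u + s *\<^sub>R v) - f (a + s *\<^sub>R u) - f (a + s *\<^sub>R v) + f a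
          = s\<^sup>2 * ((H (a + \<xi> *\<^sub>R u + \<zeta> *\<^sub>R v) *v v) \<bullet> u)"
        using second_difference_mean_value[OF s] by blast
      obtain \<xi>' \<zeta>' where 2: "0 < \<xi>'" "\<xi>' < s" "0 < \<zeta>'" "\<zeta>' < s"
        "f (a + s *\<^sub>R v + s *\<^sub>R u) - f (a + s *\<^sub>R v) - f (a + s *\<^sub>R u) + f a
          = s\<^sup>2 * ((H (a + \<xi>' *\<^sub>R v + \<zeta>' *\<^sub>R u) *v u) \<bullet> v)"
        using second_difference_mean_value[OF s] by blast
      have "s\<^sup>2 * ((H (a + \<xi> *\<^sub>R u + \<zeta> *\<^sub>R v) *v v) \<bullet> u)
          = s\<^sup>2 * ((H (a + \<zeta>' *\<^sub>R u + \<xi>' *\<^sub>R v) *v u) \<bullet> v)"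
        using 1(5) 2(5) by (simp add: algebra_simps)
      then have "(H (a + \<xi> *\<^sub>R u + \<zeta> *\<^sub>R v) *v v) \<bullet> u = (H (a + \<zeta>' *\<^sub>R u + \<xi>' *\<^sub>R v) *v u) \<bullet> v"
        using s by simp
      moreover note close[OF 1(1-4), of v u] close[OF 2(3,4,1,2), of u v]
      ultimately have "\<bar>(H a *v v) \<bullet> u - (H a *v u) \<bullet> v\<bar>
          \<le> L * (s * (norm u + norm v)) * norm v * norm u
            + L * (s * (norm u + norm v)) * norm u * norm v"
        unfolding inner_diff_left by linarith
      then show ?thesis
        by (simp add: C_def algebra_simps)
    qed
    have "0 \<le> C" using assms by (simp add: C_def)
    have "\<bar>(H a *v v) \<bullet> u - (H a *v u) \<bullet> v\<bar> \<le> e" if "0 < e" for e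
    proof -
      have "\<bar>(H a *v v) \<bullet> u - (H a *v u) \<bullet> v\<bar> \<le> C * (e / (C + 1))"
        using \<open>0 \<le> C\<close> that by (intro bound) simp
      also have "\<dots> \<le> e" using \<open>0 \<le> C\<close> that by (simp add: field_simps)
      finally show ?thesis .
    qed
    then have "\<bar>(H a *v v) \<bullet> u - (H a *v u) \<bullet> v\<bar> \<le> 0"
      by (rule field_le_epsilon[where y = 0, simplified])
    then show ?thesis by simp
  qed
  then have "adjoint ((*v) (H a)) = (*v) (H a)"
    by (intro adjoint_unique) (simp add: inner_commute)
  then have "(*v) (transpose (H a)) = (*v) (H a)" by (simp only: adjoint_matrix)
  then show ?thesis by (metis matrix_of_matrix_vector_mul)
qed

end

section \<open>Krylov subspaces and Lanczos bases\<close>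

lemma subspace_krylov: "subspace (krylov H g t)"
  by (simp add: krylov_def)

lemma krylov_0: "krylov H g 0 = {0}"
  by (simp add: krylov_def)

lemma krylov_mono: "s \<le> t \<Longrightarrow> krylov H g s \<subseteq> krylov H g t"
  unfolding krylov_def by (intro span_mono image_mono) auto

lemma power_in_krylov: "i < t \<Longrightarrow> ((*v) H ^^ i) g \<in> krylov H g t"
  unfolding krylov_def by (auto intro: span_base)

lemma krylov_subset:
  assumes "subspace S" "\<And>i. i < t \<Longrightarrow> ((*v) H ^^ i) g \<in> S"
  shows "krylov H g t \<subseteq> S"
  unfolding krylov_def using assms by (intro span_minimal) auto

lemma krylov_apply:
  assumes "v \<in> krylov H g t"
  shows "H *v v \<in> krylov H g (Suc t)"
proof -
  have "subspace {v. H *v v \<in> krylov H g (Suc t)}"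
    by (rule linear_subspace_vimage[unfolded vimage_def]) (auto simp: subspace_krylov)
  then have "krylov H g t \<subseteq> {v. H *v v \<in> krylov H g (Suc t)}"
    by (rule krylov_subset) (use power_in_krylov[of "Suc _" "Suc t" H g] in auto)
  then show ?thesis using assms by auto
qed

lemma dim_krylov_le: "dim (krylov H g t) \<le> t"
proof -
  have "dim (krylov H g t) \<le> card ((\<lambda>i. ((*v) H ^^ i) g) ` {..<t})"
    unfolding krylov_def dim_span by (rule dim_le_card') simp
  also have "\<dots> \<le> t" by (metis card_image_le card_lessThan finite_lessThan)
  finally show ?thesis .
qed

lemma krylov_stationary:
  assumes "krylov H g (Suc m) = krylov H g m" "m \<le> t"
  shows "krylov H g t = krylov H g m"
proof -
  have "((*v) H ^^ i) g \<in> krylov H g m" for i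
  proof (induction i)
    case 0
    then show ?case using power_in_krylov[of 0 "Suc m" H g] assms(1) by simp
  next
    case (Suc i)
    then show ?case using krylov_apply assms(1) by fastforce
  qed
  then show ?thesis
    using krylov_subset[OF subspace_krylov] krylov_mono[OF assms(2)] by blast
qed

lemma dim_krylov_before_stationary:
  assumes "\<And>j. j < t \<Longrightarrow> krylov H g (Suc j) \<noteq> krylov H g j"
  shows "dim (krylov H g t) = t"
  using assms
proof (induction t)
  case 0
  then show ?case by (simp add: krylov_0)
next
  case (Suc t)
  then have "dim (krylov H g t) = t" by simp
  moreover have "dim (krylov H g t) < dim (krylov H g (Suc t))"
  proof (rule ccontr)
    assume "\<not> ?thesis"
    then have "krylov H g t = krylov H g (Suc t)"
      by (intro subspace_dim_equal subspace_krylov krylov_mono) auto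
    then show False using Suc.prems[of t] by simp
  qed
  ultimately show ?case using dim_krylov_le[of H g "Suc t"] by simp
qed

text \<open>The description of the grade determines it uniquely, and it exists because the Krylov subspaces
grow by one dimension at a time until the first time they stop growing, after which they are
constant. This turns the definite description of the grade into a usable fact.\<close>

lemma dim_krylov:
  assumes "1 \<le> t"
  shows "dim (krylov H g t) = min t (grade H g)"
proof -
  define m where "m = (LEAST j. krylov H g (Suc j) = krylov H g j)"
  have ex: "\<exists>j. krylov H g (Suc j) = krylov H g j"
  proof (rule ccontr)
    assume "\<not> ?thesis"
    then have "dim (krylov H g (Suc CARD('a))) = Suc CARD('a)"
      by (intro dim_krylov_before_stationary) auto
    then show False
      using dim_subset_UNIV[of "krylov H g (Suc CARD('a))"]
      by simp
  qed
  have stat: "krylov H g (Suc m) = krylov H g m"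
    unfolding m_def using ex by (rule LeastI_ex)
  have before: "dim (krylov H g t) = t" if "t \<le> m" for t
    using that not_less_Least[where P = "\<lambda>j. krylov H g (Suc j) = krylov H g j", folded m_def]
    by (intro dim_krylov_before_stationary) auto
  have dim: "dim (krylov H g t) = min t m" for t
    using before[of t] before[of m] krylov_stationary[OF stat, of t] by (cases "t \<le> m") auto
  have "grade H g = m"
    unfolding grade_def
  proof (rule the_equality)
    show "m' = m" if "\<forall>t\<ge>1. dim (krylov H g t) = min t m'" for m'
    proof -
      have "min (Suc (max m m')) m' = dim (krylov H g (Suc (max m m')))"
        using that by simp
      then show ?thesis unfolding dim by linarith
    qed
  qed (use dim in simp)
  then show ?thesis using dim by simp
qed

lemma orthonormal_cols_expansion:
  assumes on: "orthonormal_cols m u" and v: "v \<in> span (u ` {..<m})"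
  shows "v = (\<Sum>i<m. (u i \<bullet> v) *\<^sub>R u i)"
    and "norm v = L2_set (\<lambda>i. u i \<bullet> v) {..<m}"
proof -
  have inj: "inj_on u {..<m}"
    using on by (auto simp: inj_on_def orthonormal_cols_def) (metis zero_neq_one)
  obtain c where "v = (\<Sum>x\<in>u ` {..<m}. c x *\<^sub>R x)"
    using v by (auto simp: span_finite)
  then have vc: "v = (\<Sum>i<m. c (u i) *\<^sub>R u i)"
    by (simp add: sum.reindex inj)
  have coeff: "u i \<bullet> v = c (u i)" if "i < m" for i
  proof -
    have "u i \<bullet> v = (\<Sum>j<m. c (u j) * (u i \<bullet> u j))"
      by (simp add: vc inner_sum_right)
    also have "\<dots> = (\<Sum>j<m. if j = i then c (u i) else 0)"
      using on that by (intro sum.cong refl) (auto simp: orthonormal_cols_def)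
    finally show ?thesis using that by simp
  qed
  show v': "v = (\<Sum>i<m. (u i \<bullet> v) *\<^sub>R u i)" using vc coeff by simp
  have "v \<bullet> v = (\<Sum>i<m. (u i \<bullet> v) *\<^sub>R u i) \<bullet> v" using v' by simp
  also have "\<dots> = (\<Sum>i<m. (u i \<bullet> v)\<^sup>2)" by (simp add: inner_sum_left power2_eq_square)
  finally show "norm v = L2_set (\<lambda>i. u i \<bullet> v) {..<m}" by (simp add: L2_set_def norm_eq_sqrt_inner)
qed

text \<open>Orthonormality turns the coordinate inequality \<open>V\<^sup>T H V \<succeq> \<sigma> I\<close> into an inequality for the
vectors of the Krylov subspace, in which the basis no longer occurs.\<close>

lemma lanczos_lower_bound:
  assumes "lanczos_basis H g t V" "succeq_scaled_id t (compression H V) \<sigma>" "v \<in> krylov H g t"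
  shows "\<sigma> * (norm v)\<^sup>2 \<le> v \<bullet> (H *v v)"
proof -
  have on: "orthonormal_cols t V" and v: "v \<in> span (V ` {..<t})"
    using assms(1,3) by (auto simp: lanczos_basis_def)
  let ?c = "\<lambda>i. V i \<bullet> v"
  have n: "(norm v)\<^sup>2 = (\<Sum>i<t. (?c i)\<^sup>2)"
    by (simp add: orthonormal_cols_expansion(2)[OF on v] L2_set_def sum_nonneg)
  have "H *v v = (\<Sum>j<t. ?c j *\<^sub>R (H *v V j))"
    by (subst orthonormal_cols_expansion(1)[OF on v])
      (simp add: matrix_vector_mult_scaleR linear_sum[OF matrix_vector_mul_linear])
  then have coords: "V i \<bullet> (H *v v) = (\<Sum>j<t. compression H V i j * ?c j)" for i
    by (simp add: compression_def inner_sum_right mult_ac)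
  have "v \<bullet> (H *v v) = (\<Sum>i<t. ?c i *\<^sub>R V i) \<bullet> (H *v v)"
    using orthonormal_cols_expansion(1)[OF on v] by simp
  also have "\<dots> = (\<Sum>i<t. \<Sum>j<t. ?c i * compression H V i j * ?c j)"
    by (simp add: inner_sum_left coords sum_distrib_left mult_ac)
  finally show ?thesis
    using assms(2) n by (simp add: succeq_scaled_id_def)
qed

section \<open>MINRES before nonpositive curvature\<close>

lemma symmetric_inner:
  fixes H :: "real ^ 'n ^ 'n"
  assumes "transpose H = H"
  shows "(H *v u) \<bullet> v = u \<bullet> (H *v v)"
  by (metis assms dot_lmul_matrix vector_transpose_matrix)

text \<open>Vectors that are pairwise \<open>H\<close>-orthogonal with positive curvature are independent, and \<open>t\<close> of them
fill the Krylov subspace because its dimension is at most \<open>t\<close>. The coordinates of a vector are then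
read off by pairing it with \<open>H *v r i\<close>. It is applied with the MINRES residuals as \<open>r\<close>.\<close>

lemma conjugate_family_spans_krylov:
  fixes H :: "real ^ 'n ^ 'n"
  assumes sym: "transpose H = H"
    and pos: "\<And>i. i < t \<Longrightarrow> 0 < r i \<bullet> (H *v r i)"
    and conj: "\<And>i j. i < j \<Longrightarrow> j < t \<Longrightarrow> r j \<bullet> (H *v r i) = 0"
    and mem: "\<And>i. i < t \<Longrightarrow> r i \<in> krylov H g (Suc i)"
  shows "dim (krylov H g t) = t"
    and "v \<in> krylov H g t \<Longrightarrow> v = (\<Sum>i<t. (v \<bullet> (H *v r i) / (r i \<bullet> (H *v r i))) *\<^sub>R r i)"
proof -
  have conj': "r i \<bullet> (H *v r j) = 0" if "i < t" "j < t" "i \<noteq> j" for i j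
    using conj[of i j] conj[of j i] that symmetric_inner[OF sym, of "r i" "r j"]
    by (cases "i < j") (auto simp: inner_commute)
  have inj: "inj_on r {..<t}"
    by (rule inj_onI) (metis conj' lessThan_iff less_irrefl pos)
  have coeff: "(\<Sum>i<t. c i *\<^sub>R r i) \<bullet> (H *v r j) = c j * (r j \<bullet> (H *v r j))"
    if "j < t" for c j
  proof -
    have "(\<Sum>i<t. c i *\<^sub>R r i) \<bullet> (H *v r j) = (\<Sum>i<t. c i * (r i \<bullet> (H *v r j)))"
      by (simp add: inner_sum_left)
    also have "\<dots> = (\<Sum>i<t. if i = j then c j * (r j \<bullet> (H *v r j)) else 0)"
      using conj' that by (intro sum.cong) auto
    finally show ?thesis using that by simp
  qed
  have ind: "independent (r ` {..<t})"
  proof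
    assume "dependent (r ` {..<t})"
    then obtain c j where c: "j < t" "c (r j) \<noteq> 0" "(\<Sum>v\<in>r ` {..<t}. c v *\<^sub>R v) = 0"
      by (auto simp: dependent_finite)
    have "(\<Sum>i<t. c (r i) *\<^sub>R r i) = 0"
      using c(3) by (simp add: sum.reindex inj)
    then show False
      using coeff[OF c(1), of "\<lambda>i. c (r i)"] c(2) pos[OF c(1)] by simp
  qed
  have sub: "r ` {..<t} \<subseteq> krylov H g t"
    using mem krylov_mono[of "Suc _" t H g] by (auto simp: Suc_le_eq subset_eq)
  have card: "card (r ` {..<t}) = t" by (simp add: card_image inj)
  show dim: "dim (krylov H g t) = t"
    using dim_krylov_le[of H g t] independent_card_le_dim[OF sub ind] card by simp
  show "v = (\<Sum>i<t. (v \<bullet> (H *v r i) / (r i \<bullet> (H *v r i))) *\<^sub>R r i)" if v: "v \<in> krylov H g t"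
  proof -
    have "v \<in> span (r ` {..<t})"
      using card_ge_dim_independent[OF sub ind] card dim v by auto
    then obtain c where "v = (\<Sum>u\<in>r ` {..<t}. c u *\<^sub>R u)"
      by (auto simp: span_finite)
    then have "v = (\<Sum>i<t. c (r i) *\<^sub>R r i)" by (simp add: sum.reindex inj)
    moreover have "(\<Sum>i<t. c (r i) *\<^sub>R r i)
        = (\<Sum>i<t. (v \<bullet> (H *v r i) / (r i \<bullet> (H *v r i))) *\<^sub>R r i)"
    proof (intro sum.cong refl)
      fix i assume "i \<in> {..<t}"
      then show "c (r i) *\<^sub>R r i = (v \<bullet> (H *v r i) / (r i \<bullet> (H *v r i))) *\<^sub>R r i"
        using coeff[of i "\<lambda>i. c (r i)"] pos[of i] calculation by simp
    qed
    ultimately show ?thesis by simp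
  qed
qed

text \<open>The minimal residual is what remains of \<open>g\<close> after orthogonal projection onto the image of the
Krylov subspace under \<open>H\<close>.\<close>

lemma normal_equations_solvable:
  fixes H :: "real ^ 'n ^ 'n"
  shows "\<exists>s\<in>krylov H g t. \<forall>v\<in>krylov H g t. (H *v s + g) \<bullet> (H *v v) = 0"
proof -
  have span: "span ((*v) H ` krylov H g t) = (*v) H ` krylov H g t"
    by (simp add: linear_subspace_image subspace_krylov)
  obtain y z where "y \<in> span ((*v) H ` krylov H g t)" "- g = y + z"
    "\<And>w. w \<in> span ((*v) H ` krylov H g t) \<Longrightarrow> orthogonal z w"
    using orthogonal_subspace_decomp_exists[of "(*v) H ` krylov H g t" "- g"] by blast
  then obtain s where s: "s \<in> krylov H g t" "- g = H *v s + z"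
    and z: "\<And>v. v \<in> krylov H g t \<Longrightarrow> z \<bullet> (H *v v) = 0"
    unfolding span by (auto simp: orthogonal_def)
  have "g = - (H *v s + z)" by (metis s(2) minus_minus)
  then have "H *v s + g = - z" by simp
  then show ?thesis using s(1) z by (intro bexI[of _ s] ballI) simp_all
qed

text \<open>By Pythagoras, solutions of the normal equations are exactly the minimizers, and all of
them have the same image under \<open>H\<close>; so uniqueness is injectivity of \<open>H\<close> on the Krylov subspace.\<close>

lemma minres_minimizer_iff:
  assumes s0: "s0 \<in> krylov H g t" "\<forall>v\<in>krylov H g t. (H *v s0 + g) \<bullet> (H *v v) = 0"
  shows "minres_minimizer H g t s \<longleftrightarrow> s \<in> krylov H g t \<and> H *v s = H *v s0"
proof -
  have pyth: "(norm (H *v s + g))\<^sup>2 = (norm (H *v s0 + g))\<^sup>2 + (norm (H *v s - H *v s0))\<^sup>2"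
    if "s \<in> krylov H g t" for s
  proof -
    have "(H *v s0 + g) \<bullet> (H *v (s - s0)) = 0"
      using s0 that subspace_diff[OF subspace_krylov] by blast
    moreover have "H *v s + g = (H *v s0 + g) + H *v (s - s0)"
      by (simp add: matrix_vector_mult_diff_distrib)
    ultimately show ?thesis
      by (simp only: power2_norm_eq_inner inner_add_left inner_add_right
          matrix_vector_mult_diff_distrib) (simp add: inner_commute)
  qed
  show ?thesis
  proof
    assume m: "minres_minimizer H g t s"
    then have s: "s \<in> krylov H g t" by (simp add: minres_minimizer_def is_arg_min_def)
    moreover have "(norm (H *v s + g))\<^sup>2 \<le> (norm (H *v s0 + g))\<^sup>2"
      using m s0(1) by (simp add: minres_minimizer_def is_arg_min_def not_less)
    ultimately show "s \<in> krylov H g t \<and> H *v s = H *v s0" using pyth[OF s] by simp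
  next
    assume s: "s \<in> krylov H g t \<and> H *v s = H *v s0"
    have "norm (H *v s0 + g) \<le> norm (H *v y + g)" if "y \<in> krylov H g t" for y
      by (rule power2_le_imp_le) (simp_all add: pyth[OF that])
    with s show "minres_minimizer H g t s"
      by (auto simp: minres_minimizer_def is_arg_min_def not_less intro: power_mono)
  qed
qed

lemma minres_step_optimal:
  assumes inj: "\<And>v. v \<in> krylov H g (Suc t) \<Longrightarrow> H *v v = 0 \<Longrightarrow> v = 0"
  shows "minres_s H g (Suc t) \<in> krylov H g (Suc t)"
    and "v \<in> krylov H g (Suc t) \<Longrightarrow> minres_r H g (Suc t) \<bullet> (H *v v) = 0"
proof -
  obtain s0 where s0: "s0 \<in> krylov H g (Suc t)"
      "\<forall>v\<in>krylov H g (Suc t). (H *v s0 + g) \<bullet> (H *v v) = 0"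
    using normal_equations_solvable by blast
  have iff: "minres_minimizer H g (Suc t) s \<longleftrightarrow> s = s0" for s
  proof -
    have "s = s0" if "s \<in> krylov H g (Suc t)" "H *v s = H *v s0"
      using inj[OF subspace_diff[OF subspace_krylov that(1) s0(1)]] that(2)
      by (simp add: matrix_vector_mult_diff_distrib)
    then show ?thesis using minres_minimizer_iff[OF s0] s0(1) by blast
  qed
  then have "minres_minimizer H g (Suc t) = (\<lambda>s. s = s0)" by blast
  then have s: "minres_s H g (Suc t) = s0" by simp
  show "minres_s H g (Suc t) \<in> krylov H g (Suc t)" using s s0 by simp
  show "minres_r H g (Suc t) \<bullet> (H *v v) = 0" if "v \<in> krylov H g (Suc t)"
  proof -
    have "minres_r H g (Suc t) = - (H *v s0 + g)"
      unfolding minres_r_def s by simp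
    then show ?thesis using s0(2) that by (simp only: inner_minus_left)
  qed
qed

text \<open>The state of MINRES while it has neither met nonpositive curvature nor solved the system. A zero
residual has zero curvature, so the condition also says that the residuals do not vanish.\<close>

definition positive_curvature_before :: "real ^ 'n ^ 'n \<Rightarrow> real ^ 'n \<Rightarrow> nat \<Rightarrow> bool" where
  "positive_curvature_before H g t \<longleftrightarrow>
     (\<forall>i<t. 0 < minres_r H g i \<bullet> (H *v minres_r H g i))"

lemma positive_curvature_before_mono:
  "positive_curvature_before H g t \<Longrightarrow> s \<le> t \<Longrightarrow> positive_curvature_before H g s"
  by (auto simp: positive_curvature_before_def)

lemma minres_r_mem_krylov:
  assumes "minres_s H g i \<in> krylov H g i"
  shows "minres_r H g i \<in> krylov H g (Suc i)"
  unfolding minres_r_def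
  using assms power_in_krylov[of 0 "Suc i" H g] krylov_apply[OF assms]
  by (intro subspace_diff subspace_neg subspace_krylov) auto

text \<open>The residuals so far are \<open>H\<close>-orthogonal because each one is orthogonal to \<open>H\<close> times its own
Krylov subspace, which contains the earlier residuals. With positive curvatures they span the next
Krylov subspace and \<open>H\<close> is injective there: a vector in the kernel has all its coordinates equal
to 0. So the next minimizer is unique, and the iterate is that minimizer instead of a repetition of
the previous one.\<close>

lemma minres_optimal:
  assumes sym: "transpose H = H"
    and "positive_curvature_before H g t"
    and "i \<le> t"
  shows "minres_s H g i \<in> krylov H g i \<and> (\<forall>v\<in>krylov H g i. minres_r H g i \<bullet> (H *v v) = 0)"
  using assms(2,3)
proof (induction t arbitrary: i)
  case 0
  then show ?case by (simp add: krylov_0)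
next
  case (Suc t)
  note IH = Suc.IH[OF positive_curvature_before_mono[OF Suc.prems(1)]]
  show ?case
  proof (cases "i = Suc t")
    case False
    then show ?thesis using IH[of i] Suc.prems by simp
  next
    case True
    let ?r = "minres_r H g"
    have pos: "0 < ?r j \<bullet> (H *v ?r j)" if "j < Suc t" for j
      using Suc.prems(1) that by (auto simp: positive_curvature_before_def)
    have mem: "?r j \<in> krylov H g (Suc j)" if "j < Suc t" for j
      using IH[of j] that by (intro minres_r_mem_krylov) simp
    have conj: "?r k \<bullet> (H *v ?r j) = 0" if "j < k" "k < Suc t" for j k
      using IH[of k] that mem[of j] krylov_mono[of "Suc j" k H g] by (auto simp: subset_eq)
    have inj: "v = 0" if "v \<in> krylov H g (Suc t)" "H *v v = 0" for v
    proof -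
      have "v \<bullet> (H *v ?r j) = 0" for j
        using symmetric_inner[OF sym, of v "?r j"] that(2) by simp
      then show ?thesis
        using conjugate_family_spans_krylov(2)[of H "Suc t" ?r g v, OF sym pos conj mem that(1)]
        by simp
    qed
    show ?thesis using minres_step_optimal[of H g t, OF inj] True by auto
  qed
qed

context
  fixes H :: "real ^ 'n ^ 'n" and g :: "real ^ 'n" and t :: nat
  assumes sym: "transpose H = H"
    and positive: "positive_curvature_before H g t"
begin

lemma minres_s_mem_krylov: "i \<le> t \<Longrightarrow> minres_s H g i \<in> krylov H g i"
  using minres_optimal[OF sym positive] by blast

lemma minres_r_orthogonal:
  "i \<le> t \<Longrightarrow> v \<in> krylov H g i \<Longrightarrow> minres_r H g i \<bullet> (H *v v) = 0"
  using minres_optimal[OF sym positive] by blast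

lemma minres_r_positive:
  "i < t \<Longrightarrow> 0 < minres_r H g i \<bullet> (H *v minres_r H g i)"
  using positive by (simp add: positive_curvature_before_def)

lemma minres_r_conjugate:
  assumes "i < j" "j < t"
  shows "minres_r H g j \<bullet> (H *v minres_r H g i) = 0"
proof (rule minres_r_orthogonal)
  have "minres_r H g i \<in> krylov H g (Suc i)"
    using assms by (intro minres_r_mem_krylov minres_s_mem_krylov) simp
  then show "minres_r H g i \<in> krylov H g j"
    using krylov_mono[of "Suc i" j H g] assms by auto
qed (use assms in simp)

lemma minres_r_mem: "i \<le> t \<Longrightarrow> minres_r H g i \<in> krylov H g (Suc i)"
  by (intro minres_r_mem_krylov minres_s_mem_krylov)

lemma dim_krylov_positive: "dim (krylov H g t) = t"
  by (rule conjugate_family_spans_krylov(1)[OF sym])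
    (auto intro: minres_r_positive minres_r_conjugate minres_r_mem)

lemma le_grade:
  assumes "1 \<le> t"
  shows "t \<le> grade H g"
  using dim_krylov[OF assms, of H g] dim_krylov_positive by simp

text \<open>The difference of two residuals lies in \<open>H\<close> times the larger Krylov subspace, to which the later
residual is orthogonal.\<close>

lemma minres_r_inner:
  assumes "i \<le> j" "j \<le> t"
  shows "minres_r H g j \<bullet> minres_r H g i = (norm (minres_r H g j))\<^sup>2"
proof -
  have "minres_s H g j - minres_s H g i \<in> krylov H g j"
    using assms krylov_mono[of i j H g] minres_s_mem_krylov[of i] minres_s_mem_krylov[of j]
    by (intro subspace_diff subspace_krylov) auto
  then have "minres_r H g j \<bullet> (H *v (minres_s H g j - minres_s H g i)) = 0"
    using assms by (intro minres_r_orthogonal) auto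
  moreover have "minres_r H g i = minres_r H g j + H *v (minres_s H g j - minres_s H g i)"
    by (simp add: minres_r_def matrix_vector_mult_diff_distrib)
  ultimately show ?thesis
    by (simp add: inner_add_right power2_norm_eq_inner)
qed

lemma gradient_inner_minres_r: "g \<bullet> minres_r H g t = - (norm (minres_r H g t))\<^sup>2"
proof -
  have "minres_r H g 0 = - g" by (simp add: minres_r_def)
  then show ?thesis using minres_r_inner[of 0 t] by (simp add: inner_commute)
qed

lemma minres_r_decreasing:
  assumes "i \<le> t"
  shows "(norm (minres_r H g t))\<^sup>2 \<le> (norm (minres_r H g i))\<^sup>2"
proof -
  have "(norm (minres_r H g t))\<^sup>2 \<le> norm (minres_r H g t) * norm (minres_r H g i)"
    using minres_r_inner[of i t] assms norm_cauchy_schwarz[of "minres_r H g t" "minres_r H g i"]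
    by simp
  then have "norm (minres_r H g t) \<le> norm (minres_r H g i)"
    by (cases "minres_r H g t = 0") (auto simp: power2_eq_square)
  then show ?thesis by (simp add: power_mono)
qed

text \<open>In the expansion of the iterate along the residuals, the coordinate at \<open>r i\<close> has the sign of
\<open>(norm (r i))\<^sup>2 - (norm (r t))\<^sup>2\<close>, which is nonnegative since residual norms decrease. Each
residual has inner product \<open>(norm (r t))\<^sup>2\<close> with \<open>r t\<close>, so the claim follows by
summation. This is what makes \<open>minres_s H g t\<close> a descent direction.\<close>

lemma minres_r_inner_minres_s_nonneg: "0 \<le> minres_r H g t \<bullet> minres_s H g t"
proof -
  let ?r = "minres_r H g" and ?s = "minres_s H g t"
  have coeff: "?s \<bullet> (H *v ?r i) = (norm (?r i))\<^sup>2 - (norm (?r t))\<^sup>2" if "i < t" for i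
  proof -
    have "?s \<bullet> (H *v ?r i) = (H *v ?s) \<bullet> ?r i" by (simp add: symmetric_inner[OF sym])
    also have "H *v ?s = ?r 0 - ?r t" by (simp add: minres_r_def)
    also have "(?r 0 - ?r t) \<bullet> ?r i = (norm (?r i))\<^sup>2 - (norm (?r t))\<^sup>2"
      using minres_r_inner[of 0 i] minres_r_inner[of i t] that
      by (simp add: inner_diff_left inner_diff_right inner_commute)
    finally show ?thesis .
  qed
  have "?s = (\<Sum>i<t. (?s \<bullet> (H *v ?r i) / (?r i \<bullet> (H *v ?r i))) *\<^sub>R ?r i)"
    by (rule conjugate_family_spans_krylov(2)[OF sym, of t ?r g])
      (auto intro: minres_r_positive minres_r_conjugate minres_r_mem minres_s_mem_krylov)
  then have "?r t \<bullet> ?s = ?r t \<bullet> (\<Sum>i<t. (?s \<bullet> (H *v ?r i) / (?r i \<bullet> (H *v ?r i))) *\<^sub>R ?r i)"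
    by simp
  also have "\<dots> = (\<Sum>i<t. ?s \<bullet> (H *v ?r i) / (?r i \<bullet> (H *v ?r i)) * (norm (?r t))\<^sup>2)"
    by (simp add: inner_sum_right minres_r_inner)
  also have "\<dots> \<ge> 0"
    using minres_r_decreasing minres_r_positive
    by (intro sum_nonneg mult_nonneg_nonneg divide_nonneg_nonneg) (auto simp: coeff less_imp_le)
  finally show ?thesis .
qed

end

lemma positive_curvature_beforeI:
  assumes "\<And>j. 1 \<le> j \<Longrightarrow> j \<le> t \<Longrightarrow> \<not> npc_detected H g j"
    and "\<And>j. j < t \<Longrightarrow> minres_r H g j \<noteq> 0"
  shows "positive_curvature_before H g t"
  unfolding positive_curvature_before_def
proof (intro allI impI)
  fix i assume "i < t"
  then show "0 < minres_r H g i \<bullet> (H *v minres_r H g i)"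
    using assms(1)[of "Suc i"] assms(2)[of i] by (auto simp: npc_detected_def)
qed

lemma undetected_imp_positive:
  assumes "\<And>j. 1 \<le> j \<Longrightarrow> j \<le> t \<Longrightarrow> \<not> npc_detected H g j \<and> \<not> sol_detected H g \<eta> j" "0 \<le> \<eta>"
  shows "positive_curvature_before H g t"
proof (rule positive_curvature_beforeI)
  show "minres_r H g j \<noteq> 0" if "j < t" for j
    using assms(1)[of "Suc j"] assms(2) that by (auto simp: sol_detected_def)
qed (use assms in blast)

text \<open>As long as nothing is detected, the Krylov subspaces keep growing, which a finite-dimensional
space does not allow.\<close>

lemma minres_terminates:
  fixes H :: "real ^ 'n ^ 'n"
  assumes sym: "transpose H = H" and "0 \<le> \<eta>"
  shows "\<exists>t. npc_detected H g t \<or> sol_detected H g \<eta> t"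
proof (rule ccontr)
  assume "\<not> ?thesis"
  then have "positive_curvature_before H g (Suc CARD('n))"
    using assms(2) by (intro undetected_imp_positive) auto
  from dim_krylov_positive[OF sym this] show False
    using dim_subset_UNIV[of "krylov H g (Suc CARD('n))"] by simp
qed

text \<open>
The state at the first detection: no test has succeeded at an earlier iteration, so all residuals
before the last one have positive curvature. The last residual itself may be zero when the solution
test succeeds, so its curvature is left open.\<close>

lemma minres_cases:
  fixes H :: "real ^ 'n ^ 'n"
  assumes sym: "transpose H = H" and \<eta>: "0 \<le> \<eta>"
  obtains t where "positive_curvature_before H g t" "npc_detected H g (Suc t)"
      "minres H g \<eta> = (minres_r H g t, NPC)"
    | t where "positive_curvature_before H g t" "\<And>j. 1 \<le> j \<Longrightarrow> j \<le> Suc t \<Longrightarrow> \<not> npc_detected H g j"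
      "sol_detected H g \<eta> (Suc t)" "minres H g \<eta> = (minres_s H g t, SOL)"
proof -
  define T where "T = (LEAST t. npc_detected H g t \<or> sol_detected H g \<eta> t)"
  have T: "npc_detected H g T \<or> sol_detected H g \<eta> T"
    unfolding T_def by (rule LeastI_ex[OF minres_terminates[OF sym \<eta>]])
  then have "1 \<le> T" by (auto simp: npc_detected_def sol_detected_def)
  then obtain t where t: "T = Suc t" by (cases T) auto
  have before: "\<not> npc_detected H g j \<and> \<not> sol_detected H g \<eta> j" if "j \<le> t" for j
    using that t not_less_Least[of j "\<lambda>t. npc_detected H g t \<or> sol_detected H g \<eta> t"]
    by (auto simp: T_def)
  have pos: "positive_curvature_before H g t"
    using before \<eta> by (intro undetected_imp_positive) auto
  have M: "minres H g \<eta> = (if npc_detected H g T then (minres_r H g t, NPC) else (minres_s H g t, SOL))"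
    using t by (simp add: minres_def Let_def T_def[symmetric])
  show thesis
  proof (cases "npc_detected H g T")
    case True
    then show thesis using that(1)[OF pos] M t by simp
  next
    case False
    have "\<not> npc_detected H g j" if "1 \<le> j" "j \<le> Suc t" for j
      using before[of j] that False t by (cases "j \<le> t") (auto simp: le_Suc_eq)
    then show thesis using that(2)[OF pos] M t False T by simp
  qed
qed

section \<open>The Hessian on the relevant eigenspaces\<close>

text \<open>A first-order condition at the minimum \<open>t = 0\<close>: the slope there is \<open>2 * b\<close>.\<close>

lemma nonneg_quadratic_imp_linear_zero:
  fixes b c :: real
  assumes "\<And>t. 0 \<le> 2 * t * b + t\<^sup>2 * c"
  shows "b = 0"
proof (rule ccontr)
  assume "b \<noteq> 0"
  define D where "D = \<bar>c\<bar> + 1"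
  have D: "0 < D" "c \<le> D" by (auto simp: D_def)
  define t where "t = - b / D"
  have "2 * t * b + t\<^sup>2 * c \<le> 2 * t * b + t\<^sup>2 * D"
    using D by (intro add_left_mono mult_left_mono) auto
  also have "\<dots> = - (b\<^sup>2 / D)"
    using D by (simp add: t_def power2_eq_square field_simps)
  also have "\<dots> < 0" using \<open>b \<noteq> 0\<close> D by simp
  finally show False using assms[of t] by simp
qed

text \<open>A maximizer \<open>w\<close> of \<open>norm (H *v v)\<close> over the unit sphere of \<open>M\<close> satisfies
\<open>H *v (H *v w) = \<mu>\<^sup>2 *\<^sub>R w\<close>, where \<open>\<mu> > 0\<close> is the maximum. Factoring the operator as
\<open>(H - \<mu>) (H + \<mu>)\<close>, either \<open>(H + \<mu>) w\<close> is an eigenvector for \<open>\<mu>\<close>, or it vanishes and \<open>w\<close> is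
an eigenvector for \<open>- \<mu>\<close>.\<close>

lemma symmetric_invariant_eigenvector:
  fixes H :: "real ^ 'n ^ 'n"
  assumes sym: "transpose H = H"
    and M: "subspace M" "\<And>v. v \<in> M \<Longrightarrow> H *v v \<in> M"
    and nz: "v\<^sub>0 \<in> M" "H *v v\<^sub>0 \<noteq> 0"
  shows "\<exists>\<mu> v. \<mu> \<noteq> 0 \<and> v \<noteq> 0 \<and> v \<in> M \<and> H *v v = \<mu> *\<^sub>R v"
proof -
  note inner = symmetric_inner[OF sym]
  define S where "S = M \<inter> sphere 0 1"
  have "v\<^sub>0 \<noteq> 0" using nz by auto
  then have v0: "v\<^sub>0 /\<^sub>R norm v\<^sub>0 \<in> S"
    using nz M(1) by (simp add: S_def subspace_scale)
  have "compact S"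
    unfolding S_def using M(1) by (simp add: closed_Int_compact closed_subspace)
  moreover have "continuous_on S (\<lambda>v. norm (H *v v))"
    by (intro continuous_on_norm linear_continuous_on matrix_vector_mul_bounded_linear)
  ultimately obtain w where w: "w \<in> S" "\<And>v. v \<in> S \<Longrightarrow> norm (H *v v) \<le> norm (H *v w)"
    using continuous_attains_sup[of S] v0 by blast
  define \<mu> where "\<mu> = norm (H *v w)"
  have "0 < norm (H *v (v\<^sub>0 /\<^sub>R norm v\<^sub>0))"
    using nz \<open>v\<^sub>0 \<noteq> 0\<close> by (simp add: matrix_vector_mult_scaleR)
  then have "0 < \<mu>" using w(2)[OF v0] unfolding \<mu>_def by linarith
  have wM: "w \<in> M" and w1: "norm w = 1" using w(1) by (auto simp: S_def)
  have bound: "norm (H *v v) \<le> \<mu> * norm v" if "v \<in> M" for v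
  proof (cases "v = 0")
    case False
    then have "norm (H *v (v /\<^sub>R norm v)) \<le> \<mu>"
      unfolding \<mu>_def using that M(1) by (intro w(2)) (simp add: S_def subspace_scale)
    then show ?thesis using False by (simp add: matrix_vector_mult_scaleR field_simps)
  qed simp
  have critical: "\<mu>\<^sup>2 *\<^sub>R w - H *v (H *v w) = 0"
  proof -
    \<comment> \<open>Moving \<open>w\<close> by \<open>t\<close> times the defect \<open>u\<close> keeps \<open>\<mu>\<^sup>2 (norm v)\<^sup>2 - (norm (H *v v))\<^sup>2\<close> nonnegative,
      and the linear term in \<open>t\<close> is \<open>u \<bullet> u\<close>.\<close>
    define u where "u = \<mu>\<^sup>2 *\<^sub>R w - H *v (H *v w)"
    have uM: "u \<in> M" unfolding u_def using M wM by (intro subspace_diff subspace_scale) auto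
    have "0 \<le> 2 * t * (u \<bullet> u) + t\<^sup>2 * (\<mu>\<^sup>2 * (norm u)\<^sup>2 - (norm (H *v u))\<^sup>2)" for t
    proof -
      have "w + t *\<^sub>R u \<in> M" using M(1) wM uM by (intro subspace_add subspace_scale)
      then have "(norm (H *v (w + t *\<^sub>R u)))\<^sup>2 \<le> (\<mu> * norm (w + t *\<^sub>R u))\<^sup>2"
        by (intro power_mono bound) auto
      moreover have "(norm (H *v (w + t *\<^sub>R u)))\<^sup>2
          = \<mu>\<^sup>2 + 2 * t * ((H *v (H *v w)) \<bullet> u) + t\<^sup>2 * (norm (H *v u))\<^sup>2"
        unfolding \<mu>_def
        by (simp add: matrix_vector_right_distrib matrix_vector_mult_scaleR power2_norm_eq_inner
            inner_add_left inner_add_right inner[of "H *v w" u]) (simp add: inner_commute power2_eq_square distrib_left)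
      moreover have "(\<mu> * norm (w + t *\<^sub>R u))\<^sup>2
          = \<mu>\<^sup>2 + 2 * t * ((\<mu>\<^sup>2 *\<^sub>R w) \<bullet> u) + t\<^sup>2 * (\<mu>\<^sup>2 * (norm u)\<^sup>2)"
      proof -
        have "(norm (w + t *\<^sub>R u))\<^sup>2 = 1 + 2 * t * (w \<bullet> u) + t\<^sup>2 * (norm u)\<^sup>2"
          using w1 by (simp add: power2_norm_eq_inner inner_add_left inner_add_right norm_eq_1)
            (simp add: inner_commute power2_eq_square distrib_left)
        then show ?thesis by (simp add: power_mult_distrib algebra_simps)
      qed
      moreover have "u \<bullet> u = (\<mu>\<^sup>2 *\<^sub>R w) \<bullet> u - (H *v (H *v w)) \<bullet> u"
        by (subst (1) u_def) (rule inner_diff_left)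
      ultimately show ?thesis
        by (simp add: right_diff_distrib)
    qed
    then have "u \<bullet> u = 0" by (rule nonneg_quadratic_imp_linear_zero)
    then show ?thesis by (simp add: u_def)
  qed
  define u where "u = H *v w + \<mu> *\<^sub>R w"
  have Hu: "H *v u = \<mu> *\<^sub>R u"
    using critical
    by (simp add: u_def matrix_vector_right_distrib matrix_vector_mult_scaleR scaleR_add_right
        power2_eq_square)
  show ?thesis
  proof (cases "u = 0")
    case True
    then have "H *v w = (- \<mu>) *\<^sub>R w" by (simp add: u_def eq_neg_iff_add_eq_0)
    moreover have "w \<noteq> 0" using w1 by auto
    ultimately show ?thesis
      using wM \<open>0 < \<mu>\<close> by (intro exI[of _ "- \<mu>"] exI[of _ w]) auto
  next
    case False
    moreover have "u \<in> M" unfolding u_def using M wM by (intro subspace_add subspace_scale) auto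
    ultimately show ?thesis
      using Hu \<open>0 < \<mu>\<close> by (intro exI[of _ \<mu>] exI[of _ u]) auto
  qed
qed

definition relevant_space :: "real ^ 'n ^ 'n \<Rightarrow> real ^ 'n \<Rightarrow> (real ^ 'n) set" where
  "relevant_space H g = span (\<Union>\<mu> \<in> {\<mu>. \<mu> \<noteq> 0 \<and> relevant_eigenvalue H g \<mu>}. eigenspace H \<mu>)"

lemma relevant_space_invariant:
  assumes "w \<in> relevant_space H g"
  shows "H *v w \<in> relevant_space H g"
proof -
  let ?E = "\<Union>\<mu> \<in> {\<mu>. \<mu> \<noteq> 0 \<and> relevant_eigenvalue H g \<mu>}. eigenspace H \<mu>"
  have "subspace {w. H *v w \<in> relevant_space H g}"
    by (rule linear_subspace_vimage[unfolded vimage_def]) (auto simp: relevant_space_def)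
  moreover have "?E \<subseteq> {w. H *v w \<in> relevant_space H g}"
  proof
    fix w assume w: "w \<in> ?E"
    then obtain \<mu> where "H *v w = \<mu> *\<^sub>R w" by (auto simp: eigenspace_def)
    moreover have "\<mu> *\<^sub>R w \<in> relevant_space H g"
      unfolding relevant_space_def using w by (intro span_scale span_base)
    ultimately show "w \<in> {w. H *v w \<in> relevant_space H g}" by simp
  qed
  ultimately have "span ?E \<subseteq> {w. H *v w \<in> relevant_space H g}"
    by (intro span_minimal)
  then show ?thesis using assms by (auto simp: relevant_space_def)
qed

text \<open>Otherwise the Krylov subspace of \<open>q\<close> contains an eigenvector \<open>v\<close> with nonzero eigenvalue. If the
eigenvalue is relevant, \<open>v\<close> lies in the relevant space and hence is orthogonal to \<open>q\<close>. If not,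
\<open>v\<close> is orthogonal to \<open>g\<close> and to the relevant eigenspaces, so again to \<open>q\<close>. But an eigenvector
orthogonal to \<open>q\<close> is orthogonal to the whole Krylov subspace of \<open>q\<close>, to which it belongs.\<close>

lemma gradient_minus_relevant_part_in_kernel:
  fixes H :: "real ^ 'n ^ 'n"
  assumes sym: "transpose H = H"
    and q: "\<And>w. w \<in> relevant_space H g \<Longrightarrow> orthogonal q w" "g - q \<in> relevant_space H g"
  shows "H *v q = 0"
proof (rule ccontr)
  assume Hq: "H *v q \<noteq> 0"
  define M where "M = span (range (\<lambda>i. ((*v) H ^^ i) q))"
  have sub: "subspace M" by (simp add: M_def)
  have gen: "((*v) H ^^ i) q \<in> M" for i unfolding M_def by (intro span_base) auto
  have inv: "H *v v \<in> M" if "v \<in> M" for v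
  proof -
    have "subspace {v. H *v v \<in> M}"
      by (rule linear_subspace_vimage[unfolded vimage_def]) (auto simp: sub)
    moreover have "range (\<lambda>i. ((*v) H ^^ i) q) \<subseteq> {v. H *v v \<in> M}"
      using gen[of "Suc _"] by auto
    ultimately have "M \<subseteq> {v. H *v v \<in> M}" unfolding M_def by (intro span_minimal)
    then show ?thesis using that by auto
  qed
  obtain \<mu> v where v: "\<mu> \<noteq> 0" "v \<noteq> 0" "v \<in> M" "H *v v = \<mu> *\<^sub>R v"
    using symmetric_invariant_eigenvector[OF sym sub inv, of q] gen[of 0] Hq by auto
  have power: "v \<bullet> ((*v) H ^^ i) q = \<mu> ^ i * (v \<bullet> q)" for i
    by (induction i) (use v(4) in \<open>auto simp: symmetric_inner[OF sym, symmetric]\<close>)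
  have perp_if: "v = 0" if "v \<bullet> q = 0"
  proof -
    have "M \<subseteq> {x. v \<bullet> x = 0}"
      unfolding M_def using power that by (intro span_minimal subspace_hyperplane) auto
    then show ?thesis using v(3) by auto
  qed
  have vE: "v \<in> eigenspace H \<mu>" using v(4) by (simp add: eigenspace_def)
  show False
  proof (cases "relevant_eigenvalue H g \<mu>")
    case True
    then have "v \<in> relevant_space H g"
      unfolding relevant_space_def using v(1) vE by (intro span_base) auto
    then show False using q(1)[of v] perp_if v(2) by (simp add: orthogonal_def inner_commute)
  next
    case False
    then have perp: "\<And>x. x \<in> eigenspace H \<mu> \<Longrightarrow> g \<bullet> x = 0"
      using vE v(2) by (auto simp: relevant_eigenvalue_def orthogonal_def)
    have "v \<bullet> w = 0" if "w \<in> relevant_space H g" for w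
    proof -
      have "v \<bullet> x = 0" if "x \<in> eigenspace H \<nu>" "relevant_eigenvalue H g \<nu>" for x \<nu>
      proof -
        have "\<nu> \<noteq> \<mu>" using that False by auto
        moreover have "\<mu> * (v \<bullet> x) = \<nu> * (v \<bullet> x)"
          using symmetric_inner[OF sym, of v x] v(4) that(1) by (simp add: eigenspace_def)
        ultimately show ?thesis by simp
      qed
      then have "relevant_space H g \<subseteq> {x. v \<bullet> x = 0}"
        unfolding relevant_space_def by (intro span_minimal subspace_hyperplane) auto
      then show ?thesis using that by auto
    qed
    then have "v \<bullet> (g - q) = 0" using q(2) by simp
    then have "v \<bullet> q = 0" using perp[OF vE] by (simp add: inner_diff_right inner_commute)
    then show False using perp_if v(2) by simp
  qed
qed

text \<open>The vectors whose component orthogonal to the relevant space is in the kernel of \<open>H\<close> form an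
\<open>H\<close>-invariant subspace that contains \<open>g\<close>, hence every Krylov subspace.\<close>

lemma krylov_relevant_decomposition:
  fixes H :: "real ^ 'n ^ 'n"
  assumes sym: "transpose H = H" and d: "d \<in> krylov H g t"
  shows "\<exists>w\<in>relevant_space H g. H *v d = H *v w \<and> norm w \<le> norm d"
proof -
  let ?W = "relevant_space H g"
  have span: "span ?W = ?W" by (simp add: relevant_space_def)
  have W: "subspace ?W" by (simp add: relevant_space_def)
  define S where "S = {d. \<exists>w\<in>?W. H *v (d - w) = 0 \<and> (\<forall>x\<in>?W. (d - w) \<bullet> x = 0)}"
  have S: "subspace S"
  proof (rule subspaceI)
    show "0 \<in> S" unfolding S_def using subspace_0[OF W] by (intro CollectI bexI[of _ 0]) auto
    show "x + y \<in> S" if xy: "x \<in> S" "y \<in> S" for x y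
    proof -
      obtain a where "a \<in> ?W" "H *v (x - a) = 0" "\<forall>z\<in>?W. (x - a) \<bullet> z = 0"
        using xy(1) unfolding S_def by blast
      moreover obtain b where "b \<in> ?W" "H *v (y - b) = 0" "\<forall>z\<in>?W. (y - b) \<bullet> z = 0"
        using xy(2) unfolding S_def by blast
      ultimately show ?thesis unfolding S_def
        by (intro CollectI bexI[of _ "a + b"])
          (auto simp: matrix_vector_mult_diff_distrib matrix_vector_right_distrib inner_diff_left
            inner_add_left subspace_add[OF W])
    qed
    show "c *\<^sub>R x \<in> S" if x: "x \<in> S" for c x
    proof -
      obtain a where "a \<in> ?W" "H *v (x - a) = 0" "\<forall>z\<in>?W. (x - a) \<bullet> z = 0"
        using x unfolding S_def by blast
      then show ?thesis unfolding S_def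
        by (intro CollectI bexI[of _ "c *\<^sub>R a"])
          (auto simp: matrix_vector_mult_diff_distrib matrix_vector_mult_scaleR inner_diff_left
            subspace_scale[OF W])
    qed
  qed
  have gS: "g \<in> S"
  proof -
    obtain y z where yz: "y \<in> span ?W" "g = y + z" "\<And>w. w \<in> span ?W \<Longrightarrow> orthogonal z w"
      using orthogonal_subspace_decomp_exists[of ?W g] by blast
    note yz = yz[unfolded span]
    have gz: "g - z = y" "g - y = z" using yz(2) by (metis add_diff_cancel_right', metis add_diff_cancel_left')
    have "H *v z = 0"
      using yz(1,3) gz(1) by (intro gradient_minus_relevant_part_in_kernel[OF sym, of g]) simp_all
    then show ?thesis
      unfolding S_def using yz(1,3) gz(2)
      by (intro CollectI bexI[of _ y]) (simp_all add: orthogonal_def)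
  qed
  have "((*v) H ^^ i) g \<in> S" for i
  proof (induction i)
    case (Suc i)
    then obtain w where w: "w \<in> ?W" "H *v (((*v) H ^^ i) g - w) = 0" by (auto simp: S_def)
    then have "((*v) H ^^ Suc i) g = H *v w"
      by (simp add: matrix_vector_mult_diff_distrib)
    then show ?case
      unfolding S_def using relevant_space_invariant[OF w(1)] by (intro CollectI bexI[of _ "H *v w"]) auto
  qed (use gS in simp)
  then have "d \<in> S" using krylov_subset[OF S] d by blast
  then obtain w where w: "w \<in> ?W" "H *v (d - w) = 0" "(d - w) \<bullet> w = 0"
    by (auto simp: S_def)
  have "(norm w)\<^sup>2 = d \<bullet> w" using w(3) by (simp add: power2_norm_eq_inner inner_diff_left)
  also have "\<dots> \<le> norm d * norm w" by (rule norm_cauchy_schwarz)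
  finally have "norm w \<le> norm d" by (cases "w = 0") (auto simp: power2_eq_square)
  then show ?thesis using w by (intro bexI[of _ w]) (auto simp: matrix_vector_mult_diff_distrib)
qed

lemma bdd_above_spectral_norm:
  fixes A :: "nat \<Rightarrow> nat \<Rightarrow> real"
  shows "bdd_above ((\<lambda>c. L2_set (\<lambda>i. \<Sum>j<m. A i j * c j) {..<m}) ` {c. L2_set c {..<m} \<le> 1})"
proof (rule bdd_aboveI2)
  fix c :: "nat \<Rightarrow> real" assume c: "c \<in> {c. L2_set c {..<m} \<le> 1}"
  have "\<bar>c j\<bar> \<le> 1" if "j < m" for j
  proof -
    have "\<bar>c j\<bar> \<le> L2_set (\<lambda>j. \<bar>c j\<bar>) {..<m}"
      by (rule member_le_L2_set) (use that in auto)
    also have "\<dots> = L2_set c {..<m}" by (simp add: L2_set_def)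
    finally show ?thesis using c by simp
  qed
  then have entry: "\<bar>A i j * c j\<bar> \<le> \<bar>A i j\<bar>" if "j < m" for i j
    using that by (simp add: abs_mult mult_left_le)
  have "L2_set (\<lambda>i. \<Sum>j<m. A i j * c j) {..<m} \<le> (\<Sum>i<m. \<bar>\<Sum>j<m. A i j * c j\<bar>)"
    by (rule L2_set_le_sum_abs)
  also have "\<dots> \<le> (\<Sum>i<m. \<Sum>j<m. \<bar>A i j\<bar>)"
    by (intro sum_mono order_trans[OF sum_abs] entry) auto
  finally show "L2_set (\<lambda>i. \<Sum>j<m. A i j * c j) {..<m} \<le> (\<Sum>i<m. \<Sum>j<m. \<bar>A i j\<bar>)" .
qed

lemma spectral_norm_nonneg: "0 \<le> spectral_norm m A"
  unfolding spectral_norm_def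
  using cSUP_upper[OF _ bdd_above_spectral_norm[of A m], of "\<lambda>_. 0"] by (simp add: L2_set_def)

lemma L2_set_le_spectral_norm:
  "L2_set (\<lambda>i. \<Sum>j<m. A i j * c j) {..<m} \<le> spectral_norm m A * L2_set c {..<m}"
proof -
  let ?F = "\<lambda>c. L2_set (\<lambda>i. \<Sum>j<m. A i j * c j) {..<m}"
  show ?thesis
  proof (cases "L2_set c {..<m} = 0")
    case True
    then have "\<forall>j<m. c j = 0" by (simp add: L2_set_eq_0_iff)
    then show ?thesis by (simp add: True L2_set_def)
  next
    case False
    define n where "n = L2_set c {..<m}"
    have n: "0 < n" using False by (simp add: n_def order_less_le)
    have scale: "L2_set (\<lambda>i. x i / n) {..<m} = L2_set x {..<m} / n" for x
      using L2_set_right_distrib[of "1 / n" x "{..<m}"] n by simp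
    have "?F (\<lambda>j. c j / n) \<le> spectral_norm m A"
      unfolding spectral_norm_def using n by (intro cSUP_upper bdd_above_spectral_norm) (simp add: scale n_def[symmetric])
    moreover have "?F (\<lambda>j. c j / n) = ?F c / n"
      by (simp add: scale[symmetric] sum_divide_distrib)
    ultimately have "?F c / n \<le> spectral_norm m A" by (simp only:)
    then show ?thesis using n by (simp only: n_def[symmetric] pos_divide_le_eq)
  qed
qed

text \<open>On its Krylov subspaces \<open>H\<close> only sees the component in the relevant space, on which the
compression to the eigenbasis represents it; so the relevant bound controls \<open>H\<close> there, however large
the other eigenvalues are.\<close>

lemma hessian_bounded_on_krylov:
  fixes H :: "real ^ 'n ^ 'n"
  assumes sym: "transpose H = H"
    and basis: "relevant_eigenbasis H g m U"
    and d: "d \<in> krylov H g t"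
  shows "norm (H *v d) \<le> spectral_norm m (compression H U) * norm d"
proof -
  obtain w where w: "w \<in> relevant_space H g" "H *v d = H *v w" "norm w \<le> norm d"
    using krylov_relevant_decomposition[OF sym d] by blast
  have on: "orthonormal_cols m U" and span: "span (U ` {..<m}) = relevant_space H g"
    using basis by (auto simp: relevant_eigenbasis_def relevant_space_def)
  note expand = orthonormal_cols_expansion[OF on, unfolded span]
  let ?c = "\<lambda>i. U i \<bullet> w"
  have "H *v w = (\<Sum>j<m. ?c j *\<^sub>R (H *v U j))"
    by (subst expand(1)[OF w(1)])
      (simp add: matrix_vector_mult_scaleR linear_sum[OF matrix_vector_mul_linear])
  then have coords: "U i \<bullet> (H *v w) = (\<Sum>j<m. compression H U i j * ?c j)" for i
    by (simp add: inner_sum_right compression_def mult_ac)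
  have "norm (H *v d) = L2_set (\<lambda>i. \<Sum>j<m. compression H U i j * ?c j) {..<m}"
    using expand(2)[OF relevant_space_invariant[OF w(1)]] w(2) by (simp add: coords)
  also have "\<dots> \<le> spectral_norm m (compression H U) * L2_set ?c {..<m}"
    by (rule L2_set_le_spectral_norm)
  also have "\<dots> = spectral_norm m (compression H U) * norm w"
    by (simp add: expand(2)[OF w(1)])
  also have "\<dots> \<le> spectral_norm m (compression H U) * norm d"
    using w(3) spectral_norm_nonneg by (rule mult_left_mono)
  finally show ?thesis .
qed

section \<open>Search directions and line search\<close>

lemma npc_direction:
  fixes H :: "real ^ 'n ^ 'n"
  assumes sym: "transpose H = H" and \<eta>: "0 \<le> \<eta>" and M: "minres H g \<eta> = (d, NPC)"
  shows "d \<noteq> 0" "d \<bullet> (H *v d) \<le> 0" "g \<bullet> d = - (norm d)\<^sup>2"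
proof -
  obtain t where t: "positive_curvature_before H g t" "npc_detected H g (Suc t)" "d = minres_r H g t"
    by (rule minres_cases[OF sym \<eta>, of g]) (use M in auto)
  then show "d \<noteq> 0" "d \<bullet> (H *v d) \<le> 0" by (auto simp: npc_detected_def)
  show "g \<bullet> d = - (norm d)\<^sup>2"
    unfolding t(3) by (rule gradient_inner_minres_r[OF sym t(1)])
qed

text \<open>Positive curvature of the last nonzero residual puts that residual into the scope of the lower
bound \<open>\<sigma>\<close>. Hence the stopping test, which compares \<open>H *v r\<close> with \<open>H *v d\<close>, bounds the residual
itself by the step. A zero step cannot be returned: it would put \<open>g\<close> into the kernel of \<open>H\<close>, and
then nonpositive curvature is detected at the first iteration.\<close>

lemma sol_direction:
  fixes H :: "real ^ 'n ^ 'n"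
  assumes sym: "transpose H = H" and \<eta>: "0 \<le> \<eta>" and "g \<noteq> 0" and \<sigma>: "0 < \<sigma>"
    and regular: "\<And>t. 1 \<le> t \<Longrightarrow> t \<le> grade H g \<Longrightarrow> (\<forall>j\<in>{1..t}. \<not> npc_detected H g j) \<Longrightarrow>
      \<exists>V. lanczos_basis H g t V \<and> succeq_scaled_id t (compression H V) \<sigma>"
    and basis: "relevant_eigenbasis H g m U" "spectral_norm m (compression H U) \<le> L\<^sub>g"
    and M: "minres H g \<eta> = (d, SOL)"
  shows "d \<noteq> 0" "\<sigma> * (norm d)\<^sup>2 \<le> d \<bullet> (H *v d)" "g \<bullet> d \<le> - (d \<bullet> (H *v d))"
    "\<sigma> * norm (g + H *v d) \<le> \<eta> * L\<^sub>g * norm d"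
proof -
  obtain t where pos: "positive_curvature_before H g t"
    and no_npc: "\<And>j. 1 \<le> j \<Longrightarrow> j \<le> Suc t \<Longrightarrow> \<not> npc_detected H g j"
    and sol: "norm (H *v minres_r H g t) \<le> \<eta> * norm (H *v d)" and d: "d = minres_s H g t"
  proof (rule minres_cases[OF sym \<eta>, of g])
    note found = that
    show thesis if npc: "minres H g \<eta> = (minres_r H g t, NPC)" for t
      using npc M by simp
    show thesis if sol: "positive_curvature_before H g t"
      "\<And>j. 1 \<le> j \<Longrightarrow> j \<le> Suc t \<Longrightarrow> \<not> npc_detected H g j"
      "sol_detected H g \<eta> (Suc t)" "minres H g \<eta> = (minres_s H g t, SOL)" for t
      using sol M by (intro found[of t]) (auto simp: sol_detected_def)
  qed
  define r where "r = minres_r H g t"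
  have r: "r = - g - H *v d" by (simp add: r_def minres_r_def d)
  show "d \<noteq> 0"
  proof
    assume "d = 0"
    then have "H *v (- g) = 0"
      using sol r by (simp add: r_def[symmetric])
    then have "npc_detected H g 1" using \<open>g \<noteq> 0\<close> by (simp add: npc_detected_def minres_r_def)
    then show False using no_npc[of 1] by simp
  qed
  then have "1 \<le> t" by (cases t) (auto simp: d)
  have lower: "\<sigma> * (norm v)\<^sup>2 \<le> v \<bullet> (H *v v)"
    if "1 \<le> s" "s \<le> Suc t" "positive_curvature_before H g s" "v \<in> krylov H g s" for s v
  proof -
    have "\<forall>j\<in>{1..s}. \<not> npc_detected H g j" using no_npc that(2) by auto
    then show ?thesis
      using regular[OF that(1) le_grade[OF sym that(3,1)]] lanczos_lower_bound that(4) by blast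
  qed
  have d_mem: "d \<in> krylov H g t" unfolding d by (rule minres_s_mem_krylov[OF sym pos]) simp
  then show "\<sigma> * (norm d)\<^sup>2 \<le> d \<bullet> (H *v d)"
    using lower[OF \<open>1 \<le> t\<close> _ pos] by simp
  have "0 \<le> r \<bullet> d" unfolding r_def d by (rule minres_r_inner_minres_s_nonneg[OF sym pos])
  then show "g \<bullet> d \<le> - (d \<bullet> (H *v d))"
    by (simp add: r inner_diff_left inner_diff_right inner_commute)
  have "\<sigma> * norm r \<le> norm (H *v r)"
  proof (cases "r = 0")
    case False
    have "0 < r \<bullet> (H *v r)"
      using no_npc[of "Suc t"] False by (auto simp: npc_detected_def r_def)
    then have "positive_curvature_before H g (Suc t)"
      using pos by (auto simp: positive_curvature_before_def r_def less_Suc_eq)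
    moreover have "r \<in> krylov H g (Suc t)"
      unfolding r_def using d_mem d by (intro minres_r_mem_krylov) simp
    ultimately have "\<sigma> * (norm r)\<^sup>2 \<le> r \<bullet> (H *v r)"
      by (intro lower[of "Suc t"]) auto
    also have "\<dots> \<le> norm r * norm (H *v r)" by (rule norm_cauchy_schwarz)
    finally show ?thesis using False by (simp add: power2_eq_square mult.left_commute)
  qed simp
  also have "\<dots> \<le> \<eta> * norm (H *v d)" using sol by (simp add: r_def)
  also have "\<dots> \<le> \<eta> * (L\<^sub>g * norm d)"
  proof (intro mult_left_mono \<eta>)
    have "norm (H *v d) \<le> spectral_norm m (compression H U) * norm d"
      by (rule hessian_bounded_on_krylov[OF sym basis(1) d_mem])
    also have "\<dots> \<le> L\<^sub>g * norm d" using basis(2) by (intro mult_right_mono) auto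
    finally show "norm (H *v d) \<le> L\<^sub>g * norm d" .
  qed
  finally have "\<sigma> * norm r \<le> \<eta> * L\<^sub>g * norm d" by (simp add: mult.assoc)
  moreover have "norm (g + H *v d) = norm r"
    unfolding r by (metis minus_add_distrib norm_minus_cancel diff_conv_add_uminus)
  ultimately show "\<sigma> * norm (g + H *v d) \<le> \<eta> * L\<^sub>g * norm d" by simp
qed

text \<open>The set of acceptable step sizes need not be closed at 0, so closedness is required only above some
acceptable \<open>a\<close>; its supremum is then attained, which gives \<open>Greatest P\<close> its meaning.\<close>

lemma Greatest_real:
  fixes P :: "real \<Rightarrow> bool"
  assumes "P a" "closed {\<alpha>. a \<le> \<alpha> \<and> P \<alpha>}" "\<And>\<alpha>. P \<alpha> \<Longrightarrow> \<alpha> \<le> B"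
  shows "P (Greatest P)" "a \<le> Greatest P"
proof -
  let ?S = "{\<alpha>. a \<le> \<alpha> \<and> P \<alpha>}"
  have bdd: "bdd_above ?S" using assms(3) by (intro bdd_aboveI[of _ B]) auto
  have "Sup ?S \<in> ?S"
    using assms(1,2) bdd by (intro closed_contains_Sup) auto
  moreover have "b \<le> Sup ?S" if "P b" for b
  proof (cases "a \<le> b")
    case True
    then show ?thesis using that bdd by (intro cSup_upper) auto
  next
    case False
    then show ?thesis using calculation by auto
  qed
  ultimately have "P (Sup ?S)" "a \<le> Sup ?S" "Greatest P = Sup ?S"
    by (auto intro: Greatest_equality)
  then show "P (Greatest P)" "a \<le> Greatest P" by auto
qed

context lipschitz_hessian
begin

lemma continuous_on_objective_line: "continuous_on S (\<lambda>t. f (a + t *\<^sub>R p))"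
  using objective_derivative_along_line
  by (intro continuous_at_imp_continuous_on ballI DERIV_isCont) blast

lemma closed_armijo: "closed {\<alpha>. f (a + \<alpha> *\<^sub>R d) \<le> f a + \<rho> * \<alpha> * c}"
  by (intro closed_Collect_le continuous_on_objective_line continuous_intros)

lemma objective_taylor_scaled:
  assumes "0 < \<alpha>"
  shows "f (a + \<alpha> *\<^sub>R d) \<le> f a + \<alpha> * (g a \<bullet> d) + \<alpha>\<^sup>2 * (d \<bullet> (H a *v d)) / 2
    + \<alpha> * (L * (\<alpha>\<^sup>2 * norm d)) * (norm d)\<^sup>2 / 6"
  using objective_taylor[of a "\<alpha> *\<^sub>R d"] assms
  by (simp add: matrix_vector_mult_scaleR power2_eq_square power3_eq_cube mult_ac)

text \<open>The cubic Taylor bound accepts every \<open>\<alpha> \<le> 1\<close> with \<open>\<alpha>\<^sup>2 * norm d \<le> D\<close>, where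
\<open>D = 3 \<sigma> (1 - 2 \<rho>) / L\<close>. So a step size below 1 is at least \<open>sqrt (D / norm d)\<close>; it also
forces \<open>D < norm d\<close>, that is, the step itself is long.\<close>

lemma sol_step_decrease:
  fixes \<rho> \<rho>' :: real
  assumes L: "0 < L" and \<sigma>: "0 < \<sigma>" and \<rho>: "0 < \<rho>" "\<rho> < 1 / 2" and d: "d \<noteq> 0"
    and curv: "\<sigma> * (norm d)\<^sup>2 \<le> d \<bullet> (H a *v d)" and descent: "g a \<bullet> d \<le> - (d \<bullet> (H a *v d))"
  defines "\<alpha> \<equiv> step_size f g \<rho> \<rho>' a d SOL"
  shows "f (a + \<alpha> *\<^sub>R d) \<le> f a - \<rho> * \<sigma> * (3 * \<sigma> * (1 - 2 * \<rho>) / L)\<^sup>2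
    \<or> \<alpha> = 1 \<and> f (a + \<alpha> *\<^sub>R d) \<le> f a - \<rho> * \<sigma> * (norm d)\<^sup>2"
proof -
  define n D where "n = norm d" and "D = 3 * \<sigma> * (1 - 2 * \<rho>) / L"
  have n: "0 < n" using d by (simp add: n_def)
  have D: "0 < D" using \<sigma> \<rho> L by (simp add: D_def)
  define P where "P \<alpha> \<longleftrightarrow> 0 < \<alpha> \<and> \<alpha> \<le> 1 \<and> f (a + \<alpha> *\<^sub>R d) \<le> f a + \<rho> * \<alpha> * (g a \<bullet> d)" for \<alpha>
  have gd: "g a \<bullet> d \<le> - \<sigma> * n\<^sup>2" using curv descent by (simp add: n_def)
  have accept: "P \<alpha>" if \<alpha>: "0 < \<alpha>" "\<alpha> \<le> 1" "\<alpha>\<^sup>2 * n \<le> D" for \<alpha>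
  proof -
    have "\<alpha>\<^sup>2 * (d \<bullet> (H a *v d)) \<le> \<alpha> * (d \<bullet> (H a *v d))"
    proof (rule mult_right_mono)
      show "0 \<le> d \<bullet> (H a *v d)" using curv \<sigma> by (meson less_imp_le mult_nonneg_nonneg order_trans zero_le_power2)
    qed (use \<alpha> in \<open>simp add: power2_eq_square\<close>)
    also have "\<dots> \<le> \<alpha> * (- (g a \<bullet> d))" using descent \<alpha> by (intro mult_left_mono) auto
    finally have quad: "\<alpha>\<^sup>2 * (d \<bullet> (H a *v d)) / 2 \<le> - (\<alpha> * (g a \<bullet> d)) / 2" by simp
    have "L * (\<alpha>\<^sup>2 * n) \<le> L * D" using \<alpha>(3) L by (intro mult_left_mono) auto
    also have "L * D = 3 * (1 - 2 * \<rho>) * \<sigma>" using L by (simp add: D_def)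
    finally have "\<alpha> * (L * (\<alpha>\<^sup>2 * n)) * n\<^sup>2 \<le> \<alpha> * (3 * (1 - 2 * \<rho>) * \<sigma>) * n\<^sup>2"
      using \<alpha> by (intro mult_right_mono mult_left_mono) auto
    also have "\<dots> = \<alpha> * (3 * (1 - 2 * \<rho>)) * (\<sigma> * n\<^sup>2)" by (simp add: mult_ac)
    also have "\<dots> \<le> \<alpha> * (3 * (1 - 2 * \<rho>)) * (- (g a \<bullet> d))"
      using \<alpha> \<rho> gd by (intro mult_left_mono) auto
    finally have cubic: "\<alpha> * (L * (\<alpha>\<^sup>2 * n)) * n\<^sup>2 / 6 \<le> - ((1 / 2 - \<rho>) * \<alpha> * (g a \<bullet> d))"
      by (simp add: algebra_simps)
    have "f (a + \<alpha> *\<^sub>R d) \<le> f a + \<rho> * \<alpha> * (g a \<bullet> d)"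
      using objective_taylor_scaled[OF \<alpha>(1), of a d] quad cubic
      by (simp add: n_def[symmetric] algebra_simps)
    then show ?thesis using \<alpha> by (simp add: P_def)
  qed
  \<comment> \<open>The largest step that the Taylor bound certifies.\<close>
  define \<beta> where "\<beta> = min 1 (sqrt (D / n))"
  have "0 < \<beta>" using D n by (simp add: \<beta>_def)
  have "\<beta>\<^sup>2 \<le> (sqrt (D / n))\<^sup>2" using \<open>0 < \<beta>\<close> by (intro power_mono) (auto simp: \<beta>_def)
  then have "\<beta>\<^sup>2 * n \<le> D" using D n by (simp add: field_simps)
  then have "P \<beta>" using \<open>0 < \<beta>\<close> by (intro accept) (auto simp: \<beta>_def)
  moreover have "closed {\<alpha>. \<beta> \<le> \<alpha> \<and> P \<alpha>}"
  proof -
    have "{\<alpha>. \<beta> \<le> \<alpha> \<and> P \<alpha>} = {\<beta>..1} \<inter> {\<alpha>. f (a + \<alpha> *\<^sub>R d) \<le> f a + \<rho> * \<alpha> * (g a \<bullet> d)}"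
      using \<open>0 < \<beta>\<close> by (auto simp: P_def)
    then show ?thesis by (simp add: closed_Int closed_armijo)
  qed
  ultimately have "P (Greatest P)" "\<beta> \<le> Greatest P"
    using Greatest_real[of P \<beta> 1] by (auto simp: P_def)
  moreover have "\<alpha> = Greatest P" by (simp add: \<alpha>_def step_size_def P_def[abs_def])
  ultimately have \<alpha>: "0 < \<alpha>" "\<alpha> \<le> 1" "f (a + \<alpha> *\<^sub>R d) \<le> f a + \<rho> * \<alpha> * (g a \<bullet> d)" "\<beta> \<le> \<alpha>"
    by (auto simp: P_def)
  have "\<rho> * \<alpha> * (g a \<bullet> d) \<le> \<rho> * \<alpha> * (- \<sigma> * n\<^sup>2)"
    using gd \<alpha> \<rho> by (intro mult_left_mono) auto
  then have decrease: "f (a + \<alpha> *\<^sub>R d) \<le> f a - \<rho> * \<sigma> * (\<alpha> * n\<^sup>2)"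
    using \<alpha>(3) by (simp add: algebra_simps)
  show ?thesis
  proof (cases "\<alpha> = 1")
    case True
    then show ?thesis using decrease by (simp add: n_def)
  next
    case False
    then have s: "sqrt (D / n) \<le> \<alpha>" "sqrt (D / n) < 1" using \<alpha> by (auto simp: \<beta>_def min_def split: if_splits)
    then have Dn: "D < n" using n by simp
    \<comment> \<open>\<open>D / n\<close> is below 1, hence below its square root.\<close>
    have "D / n = sqrt (D / n) * sqrt (D / n)" using D n by simp
    also have "\<dots> \<le> sqrt (D / n) * 1" using s D n by (intro mult_left_mono) auto
    finally have "D / n \<le> \<alpha>" using s by simp
    then have "D / n * n\<^sup>2 \<le> \<alpha> * n\<^sup>2" by (intro mult_right_mono) auto
    moreover have "D\<^sup>2 \<le> D / n * n\<^sup>2" using Dn D n by (simp add: power2_eq_square)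
    ultimately have "\<rho> * \<sigma> * D\<^sup>2 \<le> \<rho> * \<sigma> * (\<alpha> * n\<^sup>2)"
      using \<rho> \<sigma> by (intro mult_left_mono) auto
    then show ?thesis using decrease by (simp add: D_def)
  qed
qed

text \<open>Along a direction of nonpositive curvature the cubic Taylor bound has no positive quadratic term,
so every \<open>\<alpha>\<close> with \<open>\<alpha>\<^sup>2 * norm d \<le> E\<close> is accepted, where \<open>E = 6 (1 - \<rho>) / L\<close>. The bound \<open>m\<close>
on \<open>f\<close> from below guarantees that a largest acceptable step exists.\<close>

lemma npc_step_decrease:
  fixes \<rho> \<rho>' :: real
  assumes L: "0 < L" and \<rho>: "0 < \<rho>" "\<rho> < 1" and d: "d \<noteq> 0"
    and bounded: "\<And>y. m \<le> f y"
    and curv: "d \<bullet> (H a *v d) \<le> 0" and descent: "g a \<bullet> d = - (norm d)\<^sup>2"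
  defines "\<alpha> \<equiv> step_size f g \<rho>' \<rho> a d NPC"
  shows "f (a + \<alpha> *\<^sub>R d) \<le> f a - \<rho> * sqrt (6 * (1 - \<rho>) / L) * norm d powr (3 / 2)"
proof -
  define n E where "n = norm d" and "E = 6 * (1 - \<rho>) / L"
  have n: "0 < n" using d by (simp add: n_def)
  have E: "0 < E" using \<rho> L by (simp add: E_def)
  have gd: "g a \<bullet> d = - n\<^sup>2" using descent by (simp add: n_def)
  define P where "P \<alpha> \<longleftrightarrow> 0 < \<alpha> \<and> f (a + \<alpha> *\<^sub>R d) \<le> f a + \<rho> * \<alpha> * (g a \<bullet> d)" for \<alpha>
  define \<beta> where "\<beta> = sqrt (E / n)"
  have \<beta>: "0 < \<beta>" "\<beta>\<^sup>2 * n = E" using E n by (auto simp: \<beta>_def)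
  have "\<beta>\<^sup>2 * (d \<bullet> (H a *v d)) \<le> 0" using curv by (simp add: mult_nonneg_nonpos)
  moreover have "\<beta> * (L * (\<beta>\<^sup>2 * n)) * n\<^sup>2 / 6 = \<beta> * (1 - \<rho>) * n\<^sup>2"
    unfolding \<beta>(2) using L by (simp add: E_def)
  ultimately have "f (a + \<beta> *\<^sub>R d) \<le> f a + \<beta> * (g a \<bullet> d) + \<beta> * (1 - \<rho>) * n\<^sup>2"
    using objective_taylor_scaled[OF \<beta>(1), of a d, folded n_def] by linarith
  then have "f (a + \<beta> *\<^sub>R d) \<le> f a + \<rho> * \<beta> * (g a \<bullet> d)"
    by (simp add: gd algebra_simps)
  then have "P \<beta>" using \<beta> by (simp add: P_def)
  moreover have "closed {\<alpha>. \<beta> \<le> \<alpha> \<and> P \<alpha>}"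
  proof -
    have "{\<alpha>. \<beta> \<le> \<alpha> \<and> P \<alpha>} = {\<beta>..} \<inter> {\<alpha>. f (a + \<alpha> *\<^sub>R d) \<le> f a + \<rho> * \<alpha> * (g a \<bullet> d)}"
      using \<beta> by (auto simp: P_def)
    then show ?thesis by (simp add: closed_Int closed_armijo)
  qed
  moreover have "\<alpha> \<le> (f a - m) / (\<rho> * n\<^sup>2)" if "P \<alpha>" for \<alpha>
  proof -
    have "\<alpha> * (\<rho> * n\<^sup>2) \<le> f a - m"
      using that bounded[of "a + \<alpha> *\<^sub>R d"] by (simp add: P_def gd mult_ac)
    then show ?thesis using \<rho> n by (simp add: pos_le_divide_eq)
  qed
  ultimately have "P (Greatest P)" "\<beta> \<le> Greatest P"
    using Greatest_real[of P \<beta>] by blast+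
  moreover have "\<alpha> = Greatest P" by (simp add: \<alpha>_def step_size_def P_def[abs_def])
  ultimately have \<alpha>: "f (a + \<alpha> *\<^sub>R d) \<le> f a - \<rho> * (\<alpha> * n\<^sup>2)" "\<beta> \<le> \<alpha>"
    by (auto simp: P_def gd mult_ac)
  have "sqrt n * n powr (3 / 2) = n\<^sup>2"
    using n by (simp add: powr_half_sqrt[symmetric] powr_add[symmetric])
  then have "\<beta> * n\<^sup>2 = sqrt E * n powr (3 / 2)"
    using n by (simp add: \<beta>_def real_sqrt_divide field_simps)
  moreover have "\<rho> * (\<beta> * n\<^sup>2) \<le> \<rho> * (\<alpha> * n\<^sup>2)"
    using \<alpha>(2) \<rho> by (intro mult_left_mono mult_right_mono) auto
  ultimately show ?thesis using \<alpha>(1) by (simp add: n_def E_def mult_ac)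
qed

lemma gradient_zero_at_minimizer:
  assumes "\<And>y. f a \<le> f y"
  shows "g a = 0"
proof -
  have "(\<lambda>h. h \<bullet> g a) = (\<lambda>h. 0)"
    using gradient[of a] assms unfolding gderiv_def
    by (intro differential_zero_maxmin[of a UNIV f]) auto
  then have "g a \<bullet> g a = 0" by metis
  then show ?thesis by simp
qed

end

text \<open>The premises say that \<open>n\<close> lies beyond the positive root of the quadratic
\<open>\<sigma> L n\<^sup>2 / 2 + \<theta> L\<^sub>g sqrt \<epsilon> n - \<sigma> \<epsilon>\<close>; the left-hand side of the conclusion is that root in
rationalized form. Here \<open>n\<close> is the length of the step and \<open>r\<close> that of the MINRES residual.\<close>

lemma full_step_length:
  fixes \<epsilon> \<theta> \<sigma> L L\<^sub>g n r :: real
  assumes pos: "0 < \<epsilon>" "0 < \<theta>" "0 < \<sigma>" "0 < L" "0 \<le> L\<^sub>g" "0 \<le> n"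
    and r: "\<sigma> * r \<le> \<theta> * sqrt \<epsilon> * L\<^sub>g * n" and large: "\<epsilon> < r + L / 2 * n\<^sup>2"
  shows "2 * \<sigma> / (\<theta> * L\<^sub>g + sqrt (\<theta>\<^sup>2 * L\<^sub>g\<^sup>2 + 2 * \<sigma>\<^sup>2 * L)) * sqrt \<epsilon> \<le> n"
proof (rule ccontr)
  define a S c q where "a = \<theta> * L\<^sub>g" and "S = sqrt (\<theta>\<^sup>2 * L\<^sub>g\<^sup>2 + 2 * \<sigma>\<^sup>2 * L)"
    and "c = 2 * \<sigma> / (a + S)" and "q = sqrt \<epsilon>"
  assume "\<not> ?thesis"
  then have less: "n < c * q" by (simp add: a_def S_def c_def q_def)
  have a: "0 \<le> a" using pos by (simp add: a_def)
  have SS: "S\<^sup>2 = a\<^sup>2 + 2 * \<sigma>\<^sup>2 * L" using pos by (simp add: S_def a_def power_mult_distrib)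
  have S: "0 < S" unfolding S_def using pos by (simp add: add_nonneg_pos)
  have q: "0 < q" "q\<^sup>2 = \<epsilon>" using pos by (auto simp: q_def)
  have c: "0 < c" using pos a S by (simp add: c_def)
  have cS: "c * (a + S) = 2 * \<sigma>" using a S by (simp add: c_def)
  \<comment> \<open>Scaling the unknown by \<open>q\<close> removes \<open>\<epsilon>\<close> from the quadratic and leaves \<open>c\<close> as its root.\<close>
  have root: "a * c + \<sigma> * L / 2 * c\<^sup>2 = \<sigma>"
  proof -
    have "(a * c + \<sigma> * L / 2 * c\<^sup>2) * (4 * \<sigma>) = (2 * a * c) * (2 * \<sigma>) + c\<^sup>2 * (2 * \<sigma>\<^sup>2 * L)"
      by (simp add: power2_eq_square algebra_simps)
    also have "\<dots> = 2 * a * c * (c * (a + S)) + c\<^sup>2 * (S\<^sup>2 - a\<^sup>2)"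
      unfolding cS using SS by simp
    also have "\<dots> = (c * (a + S))\<^sup>2"
      by (simp add: power2_eq_square algebra_simps)
    also have "\<dots> = \<sigma> * (4 * \<sigma>)" unfolding cS by (simp add: power2_eq_square)
    finally show ?thesis using pos by simp
  qed
  have "\<sigma> * \<epsilon> < \<sigma> * (r + L / 2 * n\<^sup>2)" using large pos by (intro mult_strict_left_mono) auto
  also have "\<dots> = \<sigma> * r + \<sigma> * L / 2 * n\<^sup>2" by (simp add: algebra_simps)
  also have "\<dots> \<le> a * q * n + \<sigma> * L / 2 * n\<^sup>2" using r by (simp add: a_def q_def mult_ac)
  also have "\<dots> \<le> a * q * (c * q) + \<sigma> * L / 2 * (c * q)\<^sup>2"
    using less a q pos by (intro add_mono mult_left_mono power_mono) auto
  also have "\<dots> = (a * c + \<sigma> * L / 2 * c\<^sup>2) * q\<^sup>2" by (simp add: power2_eq_square algebra_simps)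
  also have "\<dots> = \<sigma> * \<epsilon>" unfolding root q(2) ..
  finally show False by simp
qed

lemma telescoped_decrease:
  fixes F :: "nat \<Rightarrow> real"
  assumes "\<And>k. k < n \<Longrightarrow> F (Suc k) \<le> F k - \<delta>"
  shows "F n \<le> F 0 - real n * \<delta>"
  using assms by (induction n) (force simp: algebra_simps)+

section \<open>Iteration complexity\<close>

theorem theorem3:
  fixes f :: "real ^ 'n \<Rightarrow> real"
    and g :: "real ^ 'n \<Rightarrow> real ^ 'n"
    and H :: "real ^ 'n \<Rightarrow> real ^ 'n ^ 'n"
    and x\<^sub>0 :: "real ^ 'n"
    and x :: "nat \<Rightarrow> real ^ 'n"
    and f_star \<epsilon>\<^sub>g \<theta> \<rho>\<^sub>S \<rho>\<^sub>N L\<^sub>g L\<^sub>H \<sigma> \<omega> c\<^sub>0 c\<^sub>1 c\<^sub>2 c\<^sub>3 K :: real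
  assumes gradient: "\<forall>y. GDERIV f y :> g y"
    and hessian: "\<forall>y. (g has_derivative (\<lambda>h. H y *v h)) (at y)"
    and hessian_continuous: "continuous_on UNIV H"
    and minimum: "f_star \<in> range f" "\<forall>y. f_star \<le> f y"
    and eps: "0 < \<epsilon>\<^sub>g" "\<epsilon>\<^sub>g \<le> 1"
    and theta: "0 < \<theta>"
    and rho_S: "0 < \<rho>\<^sub>S" "\<rho>\<^sub>S < 1 / 2"
    and rho_N: "0 < \<rho>\<^sub>N" "\<rho>\<^sub>N < 1"
    and iterates: "x = newton_mr f g H \<epsilon>\<^sub>g \<theta> \<rho>\<^sub>S \<rho>\<^sub>N x\<^sub>0"
    and relevant_hessian_bounded:
      "0 \<le> L\<^sub>g"
      "\<forall>y. \<exists>m U. relevant_eigenbasis (H y) (g y) m U \<and>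
                 spectral_norm m (compression (H y) U) \<le> L\<^sub>g"
    and hessian_lipschitz:
      "0 < L\<^sub>H"
      "\<forall>y z. onorm ((*v) (H y - H z)) \<le> L\<^sub>H * norm (y - z)"
    and krylov_regularity_I:
      "0 < \<sigma>"
      "\<forall>y t. 1 \<le> t \<and> t \<le> grade (H y) (g y) \<and>
             (\<forall>j\<in>{1..t}. \<not> npc_detected (H y) (g y) j) \<longrightarrow>
             (\<exists>V. lanczos_basis (H y) (g y) t V \<and>
                  succeq_scaled_id t (compression (H y) V) \<sigma>)"
    and krylov_regularity_II:
      "0 < \<omega>"
      "\<forall>k d. norm (g (x k)) > \<epsilon>\<^sub>g \<and>
             minres (H (x k)) (g (x k)) (\<theta> * sqrt \<epsilon>\<^sub>g) = (d, NPC) \<longrightarrow>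
             norm d \<ge> \<omega> * norm (g (x k))"
    and c\<^sub>0: "c\<^sub>0 = 2 * \<sigma> / (\<theta> * L\<^sub>g + sqrt (\<theta>\<^sup>2 * L\<^sub>g\<^sup>2 + 2 * \<sigma>\<^sup>2 * L\<^sub>H))"
    and c\<^sub>1: "c\<^sub>1 = \<rho>\<^sub>S * \<sigma> * (3 * \<sigma> * (1 - 2 * \<rho>\<^sub>S) / L\<^sub>H)\<^sup>2"
    and c\<^sub>2: "c\<^sub>2 = \<rho>\<^sub>S * \<sigma> * c\<^sub>0\<^sup>2"
    and c\<^sub>3: "c\<^sub>3 = \<rho>\<^sub>N * \<omega> powr (3 / 2) * sqrt (6 * (1 - \<rho>\<^sub>N) / L\<^sub>H)"
    and K: "K = (f x\<^sub>0 - f_star) * \<epsilon>\<^sub>g powr (- 3 / 2) / Min {c\<^sub>1, c\<^sub>2, c\<^sub>3}"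
  shows "\<exists>k. int k \<le> \<lceil>K\<rceil> \<and> norm (g (x k)) \<le> \<epsilon>\<^sub>g"
proof -
  interpret lipschitz_hessian f g H L\<^sub>H
    using gradient hessian hessian_lipschitz(2) by unfold_locales auto
  have sym: "transpose (H y) = H y" for y
    using hessian_lipschitz(1) by (intro hessian_symmetric) simp
  have c_pos: "0 < c\<^sub>1" "0 < c\<^sub>2" "0 < c\<^sub>3"
  proof -
    have "0 < \<theta> * L\<^sub>g + sqrt (\<theta>\<^sup>2 * L\<^sub>g\<^sup>2 + 2 * \<sigma>\<^sup>2 * L\<^sub>H)"
      using theta relevant_hessian_bounded(1) krylov_regularity_I(1) hessian_lipschitz(1)
      by (intro add_nonneg_pos) (auto intro: add_nonneg_pos)
    then have "0 < c\<^sub>0" using krylov_regularity_I(1) by (simp add: c\<^sub>0)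
    then show "0 < c\<^sub>1" "0 < c\<^sub>2" "0 < c\<^sub>3"
      using rho_S rho_N krylov_regularity_I(1) krylov_regularity_II(1) hessian_lipschitz(1)
      by (auto simp: c\<^sub>1 c\<^sub>2 c\<^sub>3)
  qed
  define c where "c = Min {c\<^sub>1, c\<^sub>2, c\<^sub>3}"
  have c: "0 < c" "c \<le> c\<^sub>1" "c \<le> c\<^sub>2" "c \<le> c\<^sub>3" using c_pos by (auto simp: c_def)
  define \<delta> where "\<delta> = c * \<epsilon>\<^sub>g powr (3 / 2)"
  have "\<epsilon>\<^sub>g powr (3 / 2) \<le> \<epsilon>\<^sub>g powr 1" using eps by (intro powr_mono') auto
  then have eps_powr: "\<epsilon>\<^sub>g powr (3 / 2) \<le> \<epsilon>\<^sub>g" using eps by simp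
  have \<delta>_le: "\<delta> \<le> c' * \<epsilon>\<^sub>g" if "c \<le> c'" for c'
    unfolding \<delta>_def using that c(1) eps_powr eps by (intro mult_mono) auto
  have \<eta>: "0 \<le> \<theta> * sqrt \<epsilon>\<^sub>g" using theta eps by simp
  have step: "f (x (Suc k)) \<le> f (x k) - \<delta>"
    if large: "\<epsilon>\<^sub>g < norm (g (x k))" "\<epsilon>\<^sub>g < norm (g (x (Suc k)))" for k
  proof -
    obtain d flag where M: "minres (H (x k)) (g (x k)) (\<theta> * sqrt \<epsilon>\<^sub>g) = (d, flag)"
      by (cases "minres (H (x k)) (g (x k)) (\<theta> * sqrt \<epsilon>\<^sub>g)")
    have next_x: "x (Suc k) = x k + step_size f g \<rho>\<^sub>S \<rho>\<^sub>N (x k) d flag *\<^sub>R d"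
      using large(1) M unfolding iterates by (simp add: Let_def)
    show ?thesis
    proof (cases flag)
      case SOL
      obtain m U where U: "relevant_eigenbasis (H (x k)) (g (x k)) m U"
          "spectral_norm m (compression (H (x k)) U) \<le> L\<^sub>g"
        using relevant_hessian_bounded(2) by blast
      have "g (x k) \<noteq> 0" using large(1) eps by auto
      note dir = sol_direction[OF sym \<eta> this krylov_regularity_I(1) _ U M[unfolded SOL]]
      have d: "d \<noteq> 0" "\<sigma> * (norm d)\<^sup>2 \<le> d \<bullet> (H (x k) *v d)"
        "g (x k) \<bullet> d \<le> - (d \<bullet> (H (x k) *v d))"
        "\<sigma> * norm (g (x k) + H (x k) *v d) \<le> \<theta> * sqrt \<epsilon>\<^sub>g * L\<^sub>g * norm d"
        using krylov_regularity_I(2) by (intro dir; simp)+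
      from sol_step_decrease[OF hessian_lipschitz(1) krylov_regularity_I(1) rho_S d(1-3), of \<rho>\<^sub>N]
      consider "f (x (Suc k)) \<le> f (x k) - c\<^sub>1"
        | "step_size f g \<rho>\<^sub>S \<rho>\<^sub>N (x k) d SOL = 1"
          "f (x (Suc k)) \<le> f (x k) - \<rho>\<^sub>S * \<sigma> * (norm d)\<^sup>2"
        unfolding c\<^sub>1 next_x SOL by blast
      \<comment> \<open>A shortened step gains the constant \<open>c\<^sub>1\<close>. A full step gains in proportion to its
        squared length, and it is long because the gradient at its end point is large.\<close>
      then show ?thesis
      proof cases
        case 1
        have "c\<^sub>1 * \<epsilon>\<^sub>g \<le> c\<^sub>1" using c_pos(1) eps by simp
        then show ?thesis using 1 \<delta>_le[OF c(2)] by linarith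
      next
        case 2
        have x': "x (Suc k) = x k + d" unfolding next_x SOL 2(1) by simp
        have "norm (g (x k + d))
            \<le> norm (g (x k) + H (x k) *v d) + norm (g (x k + d) - g (x k) - H (x k) *v d)"
          by (rule order_trans[OF _ norm_triangle_ineq]) (simp add: algebra_simps)
        also have "\<dots> \<le> norm (g (x k) + H (x k) *v d) + L\<^sub>H / 2 * (norm d)\<^sup>2"
          by (intro add_left_mono gradient_taylor)
        finally have "\<epsilon>\<^sub>g < norm (g (x k) + H (x k) *v d) + L\<^sub>H / 2 * (norm d)\<^sup>2"
          using large(2) x' by simp
        then have "c\<^sub>0 * sqrt \<epsilon>\<^sub>g \<le> norm d"
          unfolding c\<^sub>0 using d(4) eps theta krylov_regularity_I(1) hessian_lipschitz(1)
            relevant_hessian_bounded(1)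
          by (intro full_step_length[where r = "norm (g (x k) + H (x k) *v d)"]) auto
        moreover have "0 \<le> c\<^sub>0"
          unfolding c\<^sub>0 using theta relevant_hessian_bounded(1) krylov_regularity_I(1)
            hessian_lipschitz(1) by simp
        ultimately have "(c\<^sub>0 * sqrt \<epsilon>\<^sub>g)\<^sup>2 \<le> (norm d)\<^sup>2"
          using eps by (intro power_mono) auto
        then have "\<rho>\<^sub>S * \<sigma> * (c\<^sub>0\<^sup>2 * \<epsilon>\<^sub>g) \<le> \<rho>\<^sub>S * \<sigma> * (norm d)\<^sup>2"
          using eps rho_S krylov_regularity_I(1)
          by (intro mult_left_mono) (auto simp: power_mult_distrib)
        then have "c\<^sub>2 * \<epsilon>\<^sub>g \<le> \<rho>\<^sub>S * \<sigma> * (norm d)\<^sup>2" by (simp add: c\<^sub>2 mult.assoc)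
        then show ?thesis using 2(2) \<delta>_le[OF c(3)] by linarith
      qed
    next
      case NPC
      note d = npc_direction[OF sym \<eta> M[unfolded NPC]]
      have "\<omega> * \<epsilon>\<^sub>g \<le> \<omega> * norm (g (x k))" using large krylov_regularity_II(1) by simp
      also have "\<dots> \<le> norm d"
        using krylov_regularity_II(2) large(1) M[unfolded NPC] by blast
      finally have "(\<omega> * \<epsilon>\<^sub>g) powr (3 / 2) \<le> norm d powr (3 / 2)"
        using eps krylov_regularity_II(1) by (intro powr_mono2) auto
      then have "\<omega> powr (3 / 2) * \<epsilon>\<^sub>g powr (3 / 2) \<le> norm d powr (3 / 2)"
        using eps krylov_regularity_II(1) by (simp add: powr_mult)
      then have "\<rho>\<^sub>N * sqrt (6 * (1 - \<rho>\<^sub>N) / L\<^sub>H) * (\<omega> powr (3 / 2) * \<epsilon>\<^sub>g powr (3 / 2))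
          \<le> \<rho>\<^sub>N * sqrt (6 * (1 - \<rho>\<^sub>N) / L\<^sub>H) * norm d powr (3 / 2)"
        using rho_N hessian_lipschitz(1) by (intro mult_left_mono) auto
      moreover have "c\<^sub>3 * \<epsilon>\<^sub>g powr (3 / 2)
          = \<rho>\<^sub>N * sqrt (6 * (1 - \<rho>\<^sub>N) / L\<^sub>H) * (\<omega> powr (3 / 2) * \<epsilon>\<^sub>g powr (3 / 2))"
        unfolding c\<^sub>3 by (simp only: mult_ac)
      moreover have "\<delta> \<le> c\<^sub>3 * \<epsilon>\<^sub>g powr (3 / 2)"
        unfolding \<delta>_def using c(4) by (intro mult_right_mono) auto
      moreover have "f (x (Suc k))
          \<le> f (x k) - \<rho>\<^sub>N * sqrt (6 * (1 - \<rho>\<^sub>N) / L\<^sub>H) * norm d powr (3 / 2)"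
        unfolding next_x NPC
        using minimum(2) by (intro npc_step_decrease[OF hessian_lipschitz(1) rho_N d(1) _ d(2,3)]) auto
      ultimately show ?thesis by linarith
    qed
  qed
  show ?thesis
  proof (rule ccontr)
    \<comment> \<open>After \<open>\<lceil>K\<rceil>\<close> decreases the objective would be at its minimum, where the gradient
      vanishes; so rounding up \<open>K\<close> is enough.\<close>
    assume "\<not> ?thesis"
    then have large: "\<epsilon>\<^sub>g < norm (g (x k))" if "int k \<le> \<lceil>K\<rceil>" for k
      using that by (meson not_le)
    have \<delta>_pos: "0 < \<delta>" using c(1) eps by (simp add: \<delta>_def)
    have "0 \<le> K"
      unfolding K c_def[symmetric] using minimum(2) c(1) by (intro divide_nonneg_pos mult_nonneg_nonneg) auto
    define n where "n = nat \<lceil>K\<rceil>"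
    have n: "int n = \<lceil>K\<rceil>" using \<open>0 \<le> K\<close> by (simp add: n_def)
    have "K * \<delta> = (f x\<^sub>0 - f_star) * (\<epsilon>\<^sub>g powr (- 3 / 2) * \<epsilon>\<^sub>g powr (3 / 2))"
      using c(1) by (simp add: K c_def[symmetric] \<delta>_def)
    also have "\<dots> = f x\<^sub>0 - f_star" using eps by (simp add: powr_add[symmetric])
    finally have K\<delta>: "K * \<delta> = f x\<^sub>0 - f_star" .
    have "f (x n) \<le> f (x 0) - real n * \<delta>"
      using n by (intro telescoped_decrease[where F = "\<lambda>k. f (x k)"] step large) auto
    also have "\<dots> \<le> f (x 0) - K * \<delta>"
    proof -
      have "K \<le> real n" using n by (metis le_of_int_ceiling of_int_of_nat_eq)
      then show ?thesis using \<delta>_pos by (simp add: mult_right_mono)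
    qed
    also have "\<dots> = f_star" using K\<delta> by (simp add: iterates)
    finally have "f (x n) \<le> f_star" .
    then have "g (x n) = 0"
      using minimum(2) order_trans by (intro gradient_zero_at_minimizer) blast
    then show False using large[of n] n eps by simp
  qed
qed

end
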